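(* For every integer $n\geq 1$, $$\left|Q_n(1) - (-1)^n\left(\sqrt{\frac{e}{\pi}}\cdot \frac{n!}{n^{1/4}}\cos\left(2\sqrt{n}-\frac{\pi}{4}\right)-\frac{17}{48}\sqrt{\frac{e}{\pi}}\,\frac{n!}{n^{3/4}}\sin\left(2\sqrt{n}-\frac{\pi}{4}\right)\right)\right|<\frac{0.51\, n!}{n}.$$
   Context: For an integer $n\ge 0$, $Q_n$ denotes the polynomial $$Q_n(x)= \sum_{k=0}^{n} k! \binom{n}{k}^2 (-x)^{k}.$$ *)

theory Defs
  imports "HOL-Computational_Algebra.Polynomial" Complex_Main
begin

definition Q :: "nat \<Rightarrow> real poly" where
  "Q n = (\<Sum>k=0..n. smult (fact k * (of_nat (n choose k))\<^sup>2) ((- [:0, 1:]) ^ k))"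

lemma poly_Q: "poly (Q n) x = (\<Sum>k=0..n. fact k * (of_nat (n choose k))\<^sup>2 * (- x) ^ k)"
  by (simp add: Q_def poly_sum)

end

theory Submission
  imports Defs "HOL-Complex_Analysis.Complex_Analysis"
begin

text \<open>
  Reversing the sum gives \<open>Q\<^sub>n(1) = (-1)\<^sup>n n! L\<^sub>n(1)\<close> with the Laguerre polynomial \<open>L\<^sub>n\<close>
  (\<open>poly_Q_1\<close>), so the claim is an expansion of \<open>L\<^sub>n(1)\<close> with an explicit error \<open>O(1/n)\<close>.
  Put \<open>\<nu> = sqrt (4 n + 1)\<close>.

  \<^item> Integrating termwise, \<open>L\<^sub>n(1)\<close> is the mean over \<open>0 \<le> x \<le> \<pi>/2\<close> of \<open>h(sin x)\<close>, where
    \<open>h(t) = H\<^bsub>2n\<^esub>(t) / H\<^bsub>2n\<^esub>(0)\<close> is an even Hermite polynomial (\<open>has_integral_even_hermite_sin\<close>).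
    This trades the Laguerre equation, singular at the origin, for the regular equation
    \<open>y'' + (\<nu>\<^sup>2 - t\<^sup>2) y = 0\<close> of \<open>y(t) = exp (- t\<^sup>2/2) h(t)\<close>. On \<open>[0, 1]\<close> the term \<open>t\<^sup>2 y\<close> is a
    small perturbation, and \<open>y = cos (\<nu> t) + t\<^sup>3 / (6 \<nu>) sin (\<nu> t)\<close> up to \<open>O(1 / \<nu>\<^sup>2)\<close>
    (\<open>even_hermite_approx\<close>).

  \<^item> The remaining integral of \<open>exp (t\<^sup>2/2) (cos (\<nu> t) + t\<^sup>3 / (6 \<nu>) sin (\<nu> t))\<close>, \<open>t = sin x\<close>, is
    the real part of an integral of \<open>F(t) / sqrt (1 - t\<^sup>2)\<close> over \<open>[0, 1]\<close>, with \<open>F\<close> entire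
    and bounded for \<open>Re t\<close> in \<open>[0, 1]\<close> and \<open>Im t \<ge> 0\<close>. Move the path to the imaginary axis
    followed by the ray \<open>1 + i s\<close>. The imaginary axis contributes a purely imaginary number, so everything
    comes from the branch point \<open>t = 1\<close> (\<open>quarter_strip_contour_shift\<close>). On the ray the
    integrand is \<open>exp (- \<nu> s) s\<^bsup>-1/2\<^esup>\<close> times a smooth amplitude, and expanding the amplitude
    at \<open>s = 0\<close> yields Gamma integrals: the leading term with \<open>cos (\<nu> - \<pi>/4)\<close>, the correction
    with \<open>sin (\<nu> - \<pi>/4)\<close>, and an error \<open>O(\<nu>\<^bsup>-5/2\<^esup>)\<close> (\<open>integral_hermite_approx_asymptotics\<close>).

  \<^item> Replacing \<open>\<nu>\<close> by \<open>2 sqrt n\<close> shifts the phase by about \<open>1 / (4 sqrt n)\<close> (\<open>phase_change\<close>).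
    This adds \<open>- 12/48\<close> to the coefficient \<open>- 5/48\<close> of the sine and explains \<open>- 17/48\<close>.

  The three errors are at most \<open>0.118 / n\<close>, \<open>0.234 / n\<close> and \<open>0.150 / n\<close>, which together stay
  below \<open>0.51 / n\<close>.
\<close>

section \<open>Bounding increments by a majorant of the derivative\<close>

text \<open>
  The perturbed oscillator, the amplitude on the ray, and the Taylor remainders of sine and
  cosine are all estimated through an explicit antiderivative of a bound on the derivative,
  so that no integral of a bound is needed.
\<close>

lemma norm_increment_bound:
  fixes f :: "real \<Rightarrow> 'a::real_normed_vector" and g :: "real \<Rightarrow> real"
  assumes "a \<le> b"
    and f: "\<And>s. a \<le> s \<Longrightarrow> s \<le> b \<Longrightarrow> (f has_vector_derivative f' s) (at s)"
    and g: "\<And>s. a \<le> s \<Longrightarrow> s \<le> b \<Longrightarrow> (g has_real_derivative g' s) (at s)"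
    and le: "\<And>s. a < s \<Longrightarrow> s < b \<Longrightarrow> norm (f' s) \<le> g' s"
  shows "norm (f b - f a) \<le> g b - g a"
proof (cases "a = b")
  case False
  show ?thesis
  proof (rule differentiable_bound_general)
    show "continuous_on {a..b} f" "continuous_on {a..b} g"
      using f g
      by (intro continuous_at_imp_continuous_on ballI; fastforce intro: has_vector_derivative_continuous DERIV_isCont)+
    show "(f has_vector_derivative f' s) (at s)" "(g has_vector_derivative g' s) (at s)"
      if "a < s" "s < b" for s
      using that f[of s] g[of s] by (simp_all add: has_real_derivative_iff_has_vector_derivative)
  qed (use assms False in auto)
qed simp

section \<open>From the polynomial to a mean of Hermite polynomials\<close>

lemma has_integral_sin_even_power:
  "((\<lambda>x. sin x ^ (2 * j)) has_integral (pi / 2 * (fact (2 * j) / (4 ^ j * (fact j)\<^sup>2)))) {0..pi/2}"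
proof (induction j)
  case 0
  show ?case using has_integral_const_real[of "1::real" 0 "pi/2"] by simp
next
  case (Suc j)
  \<comment> \<open>The reduction formula: this combination is the derivative of \<open>- cos x * sin x ^ (2 * j + 1)\<close>,
    which vanishes at both ends.\<close>
  let ?f = "\<lambda>x::real. (2 * real j + 2) * sin x ^ (2 * Suc j) - (2 * real j + 1) * sin x ^ (2 * j)"
  have "(?f has_integral (- cos (pi/2) * sin (pi/2) ^ (2 * j + 1) - (- cos 0 * sin 0 ^ (2 * j + 1)))) {0..pi/2}"
  proof (rule fundamental_theorem_of_calculus)
    fix x :: real
    have eq: "sin x * sin x ^ (2 * j + 1) - cos x * (real (2 * j + 1) * sin x ^ (2 * j) * cos x) = ?f x"
    proof -
      have c: "cos x * cos x = 1 - sin x * sin x"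
        by (simp add: cos_squared_eq flip: power2_eq_square)
      have "cos x * (real (2 * j + 1) * sin x ^ (2 * j) * cos x) = real (2 * j + 1) * sin x ^ (2 * j) * (cos x * cos x)"
        by (simp add: algebra_simps)
      then show ?thesis unfolding c by (simp add: algebra_simps)
    qed
    have "((\<lambda>x. - cos x * sin x ^ (2 * j + 1)) has_real_derivative
             sin x * sin x ^ (2 * j + 1) - cos x * (real (2 * j + 1) * sin x ^ (2 * j) * cos x)) (at x within {0..pi/2})"
      by (rule derivative_eq_intros refl | simp)+
    then show "((\<lambda>x. - cos x * sin x ^ (2 * j + 1)) has_vector_derivative ?f x) (at x within {0..pi/2})"
      unfolding eq by (simp only: has_real_derivative_iff_has_vector_derivative)
  qed simp
  then have "(?f has_integral 0) {0..pi/2}" by simp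
  from has_integral_add[OF this has_integral_mult_right[OF Suc, of "2 * real j + 1"]]
  have "((\<lambda>x. (2 * real j + 2) * sin x ^ (2 * Suc j)) has_integral
          (2 * real j + 1) * (pi / 2 * (fact (2 * j) / (4 ^ j * (fact j)\<^sup>2)))) {0..pi/2}"
    by simp
  from has_integral_mult_right[OF this, of "1 / (2 * real j + 2)"]
  have "((\<lambda>x. sin x ^ (2 * Suc j)) has_integral
          1 / (2 * real j + 2) * ((2 * real j + 1) * (pi / 2 * (fact (2 * j) / (4 ^ j * (fact j)\<^sup>2))))) {0..pi/2}"
    by (simp add: mult.assoc[symmetric] del: power_Suc mult_Suc_right)
  moreover have "1 / (2 * real j + 2) * ((2 * real j + 1) * (pi / 2 * (fact (2 * j) / (4 ^ j * (fact j)\<^sup>2))))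
      = pi / 2 * (fact (2 * Suc j) / (4 ^ Suc j * (fact (Suc j))\<^sup>2))"
  proof -
    have f: "(fact (2 * Suc j) :: real) = 2 * (real j + 1) * (2 * real j + 1) * fact (2 * j)"
      "(fact (Suc j) :: real) = (real j + 1) * fact j"
      by (simp_all add: algebra_simps)
    show ?thesis
      unfolding f by (simp add: divide_simps power2_eq_square add_pos_pos del: fact_Suc) (simp add: algebra_simps)
  qed
  ultimately show ?case by metis
qed

definition laguerre_at_1 :: "nat \<Rightarrow> real" where
  "laguerre_at_1 n = (\<Sum>j\<le>n. of_nat (n choose j) * (-1) ^ j / fact j)"

lemma poly_Q_1: "poly (Q n) 1 = (-1) ^ n * fact n * laguerre_at_1 n"
proof -
  have "poly (Q n) 1 = (\<Sum>k\<le>n. fact k * (of_nat (n choose k))\<^sup>2 * (- 1) ^ k)"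
    by (simp add: poly_Q atMost_atLeast0)
  also have "\<dots> = (\<Sum>j\<le>n. fact (n - j) * (of_nat (n choose (n - j)))\<^sup>2 * (- 1) ^ (n - j))"
    by (rule sum.nat_diff_reindex[of _ "Suc n", simplified lessThan_Suc_atMost diff_Suc_Suc, symmetric])
       
  also have "\<dots> = (\<Sum>j\<le>n. (-1) ^ n * fact n * (of_nat (n choose j) * (-1) ^ j / fact j))"
  proof (rule sum.cong)
    fix j assume "j \<in> {..n}"
    then have j: "j \<le> n" by simp
    have b: "fact (n - j) * real (n choose j) = fact n / fact j"
      using binomial_fact[OF j, where 'a = real] by simp
    have s: "(- 1 :: real) ^ (n - j) = (-1) ^ n * (-1) ^ j"
      using j by (simp add: minus_one_power_iff)
    have "fact (n - j) * (real (n choose (n - j)))\<^sup>2 * (- 1) ^ (n - j)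
        = (fact (n - j) * real (n choose j)) * real (n choose j) * ((-1) ^ n * (-1) ^ j)"
      using j by (simp add: binomial_symmetric[symmetric] power2_eq_square s)
    also have "\<dots> = (-1) ^ n * fact n * (of_nat (n choose j) * (-1) ^ j / fact j)"
      unfolding b by simp
    finally show "fact (n - j) * (real (n choose (n - j)))\<^sup>2 * (- 1) ^ (n - j)
        = (-1) ^ n * fact n * (of_nat (n choose j) * (-1) ^ j / fact j)" .
  qed simp
  finally show ?thesis by (simp add: laguerre_at_1_def sum_distrib_left)
qed

definition hermite_coeff :: "nat \<Rightarrow> nat \<Rightarrow> real" where
  "hermite_coeff n j = (-4) ^ j * of_nat (n choose j) * fact j / fact (2 * j)"

text \<open>
  This is \<open>H\<^bsub>2n\<^esub>(t) / H\<^bsub>2n\<^esub>(0)\<close> for the physicists' Hermite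
  polynomials.
\<close>

definition even_hermite :: "nat \<Rightarrow> real \<Rightarrow> real" where
  "even_hermite n t = (\<Sum>j\<le>n. hermite_coeff n j * t ^ (2 * j))"

text \<open>
  The mean of \<open>sin\<^bsup>2j\<^esup>\<close> is \<open>(2j)! / (4\<^sup>j (j!)\<^sup>2)\<close>, which is exactly the factor that turns the
  Hermite coefficients into the Laguerre coefficients.
\<close>

lemma has_integral_even_hermite_sin:
  "((\<lambda>x. even_hermite n (sin x)) has_integral (pi / 2 * laguerre_at_1 n)) {0..pi/2}"
proof -
  have "((\<lambda>x. even_hermite n (sin x)) has_integral
          (\<Sum>j\<le>n. hermite_coeff n j * (pi / 2 * (fact (2 * j) / (4 ^ j * (fact j)\<^sup>2))))) {0..pi/2}"
    unfolding even_hermite_def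
    by (intro has_integral_sum has_integral_mult_right has_integral_sin_even_power) simp
  also have "(\<Sum>j\<le>n. hermite_coeff n j * (pi / 2 * (fact (2 * j) / (4 ^ j * (fact j)\<^sup>2))))
      = pi / 2 * laguerre_at_1 n"
    unfolding laguerre_at_1_def sum_distrib_left
  proof (rule sum.cong)
    fix j
    have "(-4 :: real) ^ j = (-1) ^ j * 4 ^ j" by (simp flip: power_mult_distrib)
    then show "hermite_coeff n j * (pi / 2 * (fact (2 * j) / (4 ^ j * (fact j)\<^sup>2)))
        = pi / 2 * (real (n choose j) * (- 1) ^ j / fact j)"
      by (simp add: hermite_coeff_def field_simps power2_eq_square)
  qed simp
  finally show ?thesis .
qed

lemma hermite_coeff_Suc:
  assumes "j \<le> n"
  shows "hermite_coeff n (Suc j) * ((2 * real j + 2) * (2 * real j + 1)) = (4 * real j - 4 * real n) * hermite_coeff n j"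
proof -
  have b: "real (n choose Suc j) * (real j + 1) = real (n choose j) * (real n - real j)"
    using binomial_absorb_comp[of n j] Suc_times_binomial_eq[of n j] binomial_absorption[of j n] assms
    by (metis (no_types, lifting) Suc_eq_plus1 binomial_absorption mult.commute of_nat_Suc of_nat_diff of_nat_mult add.commute)
  have f: "(fact (2 * Suc j) :: real) = (2 * real j + 2) * (2 * real j + 1) * fact (2 * j)"
    by (simp add: algebra_simps)
  have "hermite_coeff n (Suc j) * ((2 * real j + 2) * (2 * real j + 1))
      = (-4) ^ Suc j * real (n choose Suc j) * fact (Suc j) / fact (2 * j)"
    unfolding hermite_coeff_def f by (simp del: power_Suc fact_Suc)
  also have "\<dots> = -4 * (-4) ^ j * (real (n choose Suc j) * (real j + 1)) * fact j / fact (2 * j)"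
    by (simp add: algebra_simps)
  finally show ?thesis unfolding b hermite_coeff_def by (simp add: field_simps)
qed

definition even_hermite' :: "nat \<Rightarrow> real \<Rightarrow> real" where
  "even_hermite' n t = (\<Sum>j\<le>n. hermite_coeff n j * (real (2 * j) * t ^ (2 * j - 1)))"

lemma even_hermite_deriv: "(even_hermite n has_real_derivative even_hermite' n t) (at t)"
  unfolding even_hermite_def even_hermite'_def
  by (rule derivative_eq_intros refl sum.cong | simp)+

text \<open>
  This is Hermite's equation \<open>h'' - 2 t h' + 4 n h = 0\<close>, solved for \<open>h''\<close>: comparing coefficients,
  it amounts to the recurrence \<open>hermite_coeff_Suc\<close>.
\<close>

lemma even_hermite'_deriv:
  "(even_hermite' n has_real_derivative 2 * t * even_hermite' n t - 4 * real n * even_hermite n t) (at t)"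
proof -
  let ?c = "hermite_coeff n"
  have D: "(even_hermite' n has_real_derivative
        (\<Sum>j\<le>n. ?c j * (real (2 * j) * (real (2 * j - 1) * t ^ (2 * j - 1 - 1))))) (at t)"
    unfolding even_hermite'_def
    by (rule derivative_eq_intros refl sum.cong | simp)+
  have t1: "2 * t * even_hermite' n t = (\<Sum>j\<le>n. 4 * real j * ?c j * t ^ (2 * j))"
    unfolding even_hermite'_def sum_distrib_left
  proof (rule sum.cong)
    fix j
    show "2 * t * (?c j * (real (2 * j) * t ^ (2 * j - 1))) = 4 * real j * ?c j * t ^ (2 * j)"
      by (cases j) (simp_all add: algebra_simps)
  qed simp
  have "(\<Sum>j\<le>n. ?c j * (real (2 * j) * (real (2 * j - 1) * t ^ (2 * j - 1 - 1))))
      = (\<Sum>j<n. ?c (Suc j) * ((2 * real j + 2) * (2 * real j + 1)) * t ^ (2 * j))"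
    unfolding lessThan_Suc_atMost[symmetric] sum.lessThan_Suc_shift
    by (simp add: algebra_simps)
  also have "\<dots> = (\<Sum>j<n. (4 * real j - 4 * real n) * ?c j * t ^ (2 * j))"
    by (intro sum.cong refl) (simp only: hermite_coeff_Suc less_imp_le lessThan_iff)
  also have "\<dots> = (\<Sum>j\<le>n. (4 * real j - 4 * real n) * ?c j * t ^ (2 * j))"
    by (simp flip: lessThan_Suc_atMost)
  also have "\<dots> = 2 * t * even_hermite' n t - 4 * real n * even_hermite n t"
    unfolding t1 even_hermite_def sum_distrib_left sum_subtractf[symmetric]
    by (intro sum.cong refl) (simp add: algebra_simps)
  finally show ?thesis using D by simp
qed

section \<open>Approximate solution of the Hermite equation\<close>

text \<open>
  Variation of constants for \<open>f'' + \<nu>\<^sup>2 f = force\<close> with zero initial values: \<open>f t\<close> is the integral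
  of \<open>force s * sin (\<nu> * (t - s)) / \<nu>\<close>, so it is at most \<open>1 / \<nu>\<close> times the integral of any bound
  on the force. Here \<open>\<phi>\<close> is that integral, with \<open>\<psi>\<close> as the bound on the force.
\<close>

lemma forced_oscillator_bound:
  fixes f f1 f2 \<phi> \<psi> :: "real \<Rightarrow> real"
  assumes "\<nu> > 0" "t \<ge> 0"
    and f: "\<And>s. (f has_real_derivative f1 s) (at s)"
    and f1: "\<And>s. (f1 has_real_derivative f2 s) (at s)"
    and \<phi>: "\<And>s. (\<phi> has_real_derivative \<psi> s) (at s)"
    and "f 0 = 0" "f1 0 = 0" "\<phi> 0 = 0"
    and force: "\<And>s. 0 \<le> s \<Longrightarrow> s \<le> t \<Longrightarrow> \<bar>f2 s + \<nu>\<^sup>2 * f s\<bar> \<le> \<psi> s"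
  shows "\<bar>f t\<bar> \<le> \<phi> t / \<nu>"
proof -
  \<comment> \<open>The solution for the initial values \<open>f s\<close>, \<open>f1 s\<close> of the free oscillator at time \<open>s\<close>,
    evaluated at time \<open>t\<close>; only the force makes it change with \<open>s\<close>.\<close>
  define V where "V s = f1 s * (sin (\<nu> * (t - s)) / \<nu>) + f s * cos (\<nu> * (t - s))" for s
  have V: "(V has_real_derivative (f2 s + \<nu>\<^sup>2 * f s) * sin (\<nu> * (t - s)) / \<nu>) (at s)" for s
    unfolding V_def using \<open>\<nu> > 0\<close>
    by (auto intro!: derivative_eq_intros f f1 simp: field_simps power2_eq_square)
  have "norm (V t - V 0) \<le> \<phi> t / \<nu> - \<phi> 0 / \<nu>"
  proof (rule norm_increment_bound[OF \<open>t \<ge> 0\<close>])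
    show "(V has_vector_derivative (f2 s + \<nu>\<^sup>2 * f s) * sin (\<nu> * (t - s)) / \<nu>) (at s)" for s
      using V has_real_derivative_iff_has_vector_derivative by blast
    show "((\<lambda>s. \<phi> s / \<nu>) has_real_derivative \<psi> s / \<nu>) (at s)" for s
      by (rule DERIV_cdivide[OF \<phi>])
    fix s assume s: "0 < s" "s < t"
    have "\<bar>f2 s + \<nu>\<^sup>2 * f s\<bar> * \<bar>sin (\<nu> * (t - s))\<bar> \<le> \<psi> s * 1"
      using s force[of s] by (intro mult_mono) auto
    then show "norm ((f2 s + \<nu>\<^sup>2 * f s) * sin (\<nu> * (t - s)) / \<nu>) \<le> \<psi> s / \<nu>"
      using \<open>\<nu> > 0\<close> by (simp add: abs_mult divide_right_mono)
  qed
  moreover have "V t = f t" "V 0 = 0" using assms by (simp_all add: V_def)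
  ultimately show ?thesis using assms by simp
qed

text \<open>
  The second term is the resonant part of the response of \<open>y'' + \<nu>\<^sup>2 y = t\<^sup>2 y\<close> to the force
  \<open>t\<^sup>2 cos (\<nu> t)\<close>.
\<close>

definition hermite_approx :: "real \<Rightarrow> real \<Rightarrow> real" where
  "hermite_approx \<nu> t = cos (\<nu> * t) + t ^ 3 / (6 * \<nu>) * sin (\<nu> * t)"

text \<open>
  The error \<open>R\<close> of the approximation solves \<open>R'' + \<nu>\<^sup>2 R = t\<^sup>2 R - \<rho>\<close>, where the defect
  \<open>\<rho> = sin (\<nu> t) (t - t\<^sup>5/6) / \<nu>\<close> of \<open>hermite_approx\<close> is small. The oscillator bound is used
  twice: at the maximum of \<open>\<bar>R\<bar>\<close> it bounds this maximum, and with the maximum known it gives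
  the factor \<open>t\<^sup>2\<close>, which later saves a good part of the error.
\<close>

lemma even_hermite_approx:
  fixes n :: nat
  assumes "n \<ge> 1" "0 \<le> t" "t \<le> 1"
  defines "\<nu> \<equiv> sqrt (4 * real n + 1)"
  shows "\<bar>exp (- t\<^sup>2 / 2) * even_hermite n t - hermite_approx \<nu> t\<bar> \<le> 59/100 * t\<^sup>2 / \<nu>\<^sup>2"
proof -
  have l2: "\<nu>\<^sup>2 = 4 * real n + 1" by (simp add: \<nu>_def)
  have lb: "\<nu> \<ge> 2236/1000"
    unfolding \<nu>_def using \<open>n \<ge> 1\<close> by (intro real_le_rsqrt) (simp add: power2_eq_square)
  define R where "R t = exp (- t\<^sup>2 / 2) * even_hermite n t - hermite_approx \<nu> t" for t
  define R1 where "R1 t = exp (- t\<^sup>2 / 2) * (even_hermite' n t - t * even_hermite n t)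
      - (- \<nu> * sin (\<nu> * t) + t\<^sup>2 / (2 * \<nu>) * sin (\<nu> * t) + t ^ 3 / 6 * cos (\<nu> * t))" for t
  define R2 where "R2 t = (t\<^sup>2 - \<nu>\<^sup>2) * R t - sin (\<nu> * t) * (t - t ^ 5 / 6) / \<nu>" for t
  have dR: "(R has_real_derivative R1 t) (at t)" for t
    unfolding R_def R1_def hermite_approx_def using lb
    by (auto intro!: derivative_eq_intros even_hermite_deriv simp: field_simps power2_eq_square power3_eq_cube)
  have dR1: "(R1 has_real_derivative R2 t) (at t)" for t
  proof -
    have "(R1 has_real_derivative
        (- t * exp (- t\<^sup>2 / 2)) * (even_hermite' n t - t * even_hermite n t)
       + exp (- t\<^sup>2 / 2) * ((2 * t * even_hermite' n t - 4 * real n * even_hermite n t) - (even_hermite n t + t * even_hermite' n t))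
       - (- \<nu>\<^sup>2 * cos (\<nu> * t) + (t / \<nu> * sin (\<nu> * t) + t\<^sup>2 / 2 * cos (\<nu> * t))
          + (t\<^sup>2 / 2 * cos (\<nu> * t) - t ^ 3 / 6 * \<nu> * sin (\<nu> * t)))) (at t)"
      unfolding R1_def using lb
      by (auto intro!: derivative_eq_intros even_hermite_deriv even_hermite'_deriv simp: field_simps power2_eq_square power3_eq_cube)
    also have "(- t * exp (- t\<^sup>2 / 2)) * (even_hermite' n t - t * even_hermite n t)
       + exp (- t\<^sup>2 / 2) * ((2 * t * even_hermite' n t - 4 * real n * even_hermite n t) - (even_hermite n t + t * even_hermite' n t))
       - (- \<nu>\<^sup>2 * cos (\<nu> * t) + (t / \<nu> * sin (\<nu> * t) + t\<^sup>2 / 2 * cos (\<nu> * t))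
          + (t\<^sup>2 / 2 * cos (\<nu> * t) - t ^ 3 / 6 * \<nu> * sin (\<nu> * t)))
      = exp (- t\<^sup>2 / 2) * even_hermite n t * (t\<^sup>2 - \<nu>\<^sup>2)
       - (- \<nu>\<^sup>2 * cos (\<nu> * t) + t / \<nu> * sin (\<nu> * t) + t\<^sup>2 * cos (\<nu> * t) - t ^ 3 / 6 * \<nu> * sin (\<nu> * t))"
      unfolding l2 by (simp add: algebra_simps power2_eq_square)
    also have "\<dots> = R2 t"
      unfolding R2_def R_def hermite_approx_def using lb
      by (simp add: field_simps) (simp add: algebra_simps eval_nat_numeral)
    finally show ?thesis .
  qed
  have R0: "R 0 = 0" "R1 0 = 0"
  proof -
    have "even_hermite n 0 = 1"
      by (simp add: even_hermite_def hermite_coeff_def power_0_left sum.delta zero_power2 if_distrib[of "\<lambda>x. _ * x"] cong: if_cong)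
    moreover have "even_hermite' n 0 = 0"
      unfolding even_hermite'_def by (rule sum.neutral) (auto simp: power_0_left)
    ultimately show "R 0 = 0" "R1 0 = 0"
      by (simp_all add: R_def R1_def hermite_approx_def)
  qed
  \<comment> \<open>The force is at most \<open>M * s\<^sup>2 + s / \<nu>\<close>, as \<open>\<bar>s - s\<^sup>5/6\<bar> \<le> s\<close>.\<close>
  have bound: "\<bar>R t\<bar> \<le> (M * t ^ 3 / 3 + t\<^sup>2 / (2 * \<nu>)) / \<nu>"
    if M: "\<And>s. 0 \<le> s \<Longrightarrow> s \<le> 1 \<Longrightarrow> \<bar>R s\<bar> \<le> M" and t: "0 \<le> t" "t \<le> 1" for M t
  proof (rule forced_oscillator_bound[OF _ _ dR dR1, where \<psi> = "\<lambda>s. M * s\<^sup>2 + s / \<nu>"])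
    show "((\<lambda>s. M * s ^ 3 / 3 + s\<^sup>2 / (2 * \<nu>)) has_real_derivative M * s\<^sup>2 + s / \<nu>) (at s)" for s
      using lb by (auto intro!: derivative_eq_intros simp: field_simps)
    fix s assume s: "0 \<le> s" "s \<le> t"
    have "s ^ 5 \<le> s" using s t power_decreasing[of 1 5 s] by simp
    then have p: "\<bar>s - s ^ 5 / 6\<bar> \<le> s" using s by simp
    have "\<bar>sin (\<nu> * s)\<bar> * \<bar>s - s ^ 5 / 6\<bar> \<le> 1 * s"
      using p s by (intro mult_mono) auto
    then have a: "\<bar>sin (\<nu> * s) * (s - s ^ 5 / 6) / \<nu>\<bar> \<le> s / \<nu>"
      using lb by (simp add: abs_mult divide_right_mono)
    have b: "\<bar>s\<^sup>2 * R s\<bar> \<le> M * s\<^sup>2"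
      using M[of s] s t by (simp add: abs_mult mult.commute[of M] mult_left_mono)
    have "R2 s + \<nu>\<^sup>2 * R s = s\<^sup>2 * R s - sin (\<nu> * s) * (s - s ^ 5 / 6) / \<nu>"
      by (simp add: R2_def algebra_simps)
    then show "\<bar>R2 s + \<nu>\<^sup>2 * R s\<bar> \<le> M * s\<^sup>2 + s / \<nu>"
      using a b by linarith
  qed (use lb t R0 in auto)
  have "continuous_on {0..1} (\<lambda>t. \<bar>R t\<bar>)"
    using dR by (intro continuous_at_imp_continuous_on ballI continuous_intros) (auto intro: DERIV_isCont)
  then obtain t0 where t0: "t0 \<in> {0..1}" "\<And>s. s \<in> {0..1} \<Longrightarrow> \<bar>R s\<bar> \<le> \<bar>R t0\<bar>"
    using continuous_attains_sup[of "{0..1::real}" "\<lambda>t. \<bar>R t\<bar>"] by auto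
  define M where "M = \<bar>R t0\<bar>"
  have M: "\<And>s. 0 \<le> s \<Longrightarrow> s \<le> 1 \<Longrightarrow> \<bar>R s\<bar> \<le> M" using t0 by (auto simp: M_def)
  \<comment> \<open>The term with \<open>M\<close> on the right is absorbed on the left because \<open>\<nu> > 1/3\<close>.\<close>
  have "M \<le> (M * t0 ^ 3 / 3 + t0\<^sup>2 / (2 * \<nu>)) / \<nu>"
    using bound[of M t0] M t0(1) by (simp add: M_def)
  also have "\<dots> \<le> (M / 3 + 1 / (2 * \<nu>)) / \<nu>"
  proof -
    have "t0 ^ 3 \<le> 1" "t0\<^sup>2 \<le> 1" using t0(1) by (auto intro: power_le_one)
    moreover have "M \<ge> 0" by (simp add: M_def)
    ultimately have "M * t0 ^ 3 \<le> M" "t0\<^sup>2 / (2 * \<nu>) \<le> 1 / (2 * \<nu>)"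
      using lb by (auto simp: mult_left_le intro!: divide_right_mono)
    then show ?thesis using lb by (intro divide_right_mono) auto
  qed
  finally have "M * (\<nu> * \<nu>) \<le> M * \<nu> / 3 + 1 / 2"
    using lb by (simp add: field_simps)
  then have M1: "(M * \<nu>) * (\<nu> - 1 / 3) \<le> 1 / 2"
    by (simp add: algebra_simps)
  have "(M * \<nu>) * (19 / 10) \<le> (M * \<nu>) * (\<nu> - 1 / 3)"
    using lb by (intro mult_left_mono) (auto simp: M_def)
  with M1 have M2: "M * \<nu> \<le> 10 / 38" by simp
  have "\<bar>R t\<bar> \<le> (M * t ^ 3 / 3 + t\<^sup>2 / (2 * \<nu>)) / \<nu>"
    using bound M assms by blast
  also have "M * t ^ 3 / 3 \<le> M * t\<^sup>2 / 3"
    using assms power_decreasing[of 2 3 t] by (auto simp: M_def intro!: mult_left_mono)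
  also have "(M * t\<^sup>2 / 3 + t\<^sup>2 / (2 * \<nu>)) / \<nu> = (M * \<nu> / 3 + 1 / 2) * t\<^sup>2 / \<nu>\<^sup>2"
    using lb by (simp add: field_simps power2_eq_square)
  also have "\<dots> \<le> 59/100 * t\<^sup>2 / \<nu>\<^sup>2"
    using M2 by (intro divide_right_mono mult_right_mono) auto
  finally show ?thesis using lb by (simp add: R_def divide_right_mono)
qed

section \<open>Moving the path to the branch point\<close>

text \<open>
  Although \<open>Arcsin\<close> has a branch point at 1, it is continuous along the vertical line through
  this point, since there the square root tends to 0. This allows integrating up to the branch
  point in one application of the fundamental theorem.
\<close>

lemma isCont_Arcsin_1_plus_imag: "isCont (\<lambda>s. Arcsin (1 + \<i> * of_real s)) s"
proof (cases "s = 0")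
  case False
  then show ?thesis by (intro isCont_Arcsin' continuous_intros) auto
next
  case True
  have 1: "((\<lambda>s::real. csqrt (1 - (1 + \<i> * of_real s)\<^sup>2)) \<longlongrightarrow> 0) (at 0)"
  proof (rule tendsto_norm_zero_cancel)
    have "((\<lambda>s::real. sqrt (cmod (1 - (1 + \<i> * of_real s)\<^sup>2))) \<longlongrightarrow> sqrt (cmod (1 - (1 + \<i> * of_real 0)\<^sup>2))) (at 0)"
      by (intro tendsto_intros)
    then show "((\<lambda>s::real. cmod (csqrt (1 - (1 + \<i> * of_real s)\<^sup>2))) \<longlongrightarrow> 0) (at 0)"
      by simp
  qed
  have "((\<lambda>s::real. \<i> * (1 + \<i> * of_real s) + csqrt (1 - (1 + \<i> * of_real s)\<^sup>2)) \<longlongrightarrow> \<i> * (1 + \<i> * of_real 0) + 0) (at 0)"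
    by (intro tendsto_intros 1)
  then have "((\<lambda>s::real. - \<i> * Ln (\<i> * (1 + \<i> * of_real s) + csqrt (1 - (1 + \<i> * of_real s)\<^sup>2))) \<longlongrightarrow> - \<i> * Ln (\<i> * (1 + \<i> * of_real 0) + 0)) (at 0)"
    by (rule tendsto_mult[OF tendsto_const tendsto_Ln]) (auto simp: complex_nonpos_Reals_iff)
  then show ?thesis
    using True by (simp add: isCont_def Arcsin_def)
qed

text \<open>
  In the variable \<open>w\<close> with \<open>t = sin w\<close> the integrand \<open>F (sin w)\<close> is entire and has a primitive \<open>G\<close>,
  so that \<open>G (Arcsin z)\<close> is a primitive of \<open>F z / sqrt (1 - z\<^sup>2)\<close> off the cuts. The shift of the
  path then only compares values of \<open>G (Arcsin z)\<close> at \<open>0\<close>, \<open>1\<close>, \<open>1 + i S\<close> and \<open>i S\<close>: along the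
  imaginary axis its real part is constant as \<open>F\<close> is real there, and on the horizontal segment
  at height \<open>S\<close> it varies by at most \<open>C / S\<close>. The function \<open>W\<close> consists of the integrals along the
  ray from the branch point.
\<close>

theorem quarter_strip_contour_shift:
  fixes F :: "complex \<Rightarrow> complex"
  assumes hol: "F holomorphic_on UNIV"
    and real_axis: "\<And>s::real. Im (F (\<i> * of_real s)) = 0"
    and bounded: "\<And>u s::real. 0 \<le> u \<Longrightarrow> u \<le> 1 \<Longrightarrow> 0 \<le> s \<Longrightarrow> norm (F (of_real u + \<i> * of_real s)) \<le> C"
    and J: "((\<lambda>x. Re (F (of_real (sin x)))) has_integral J) {0..pi/2}"
  obtains W where
    "\<And>S. S \<ge> 0 \<Longrightarrow> ((\<lambda>s. \<i> * F (1 + \<i> * of_real s) / csqrt ((of_real s)\<^sup>2 - 2 * \<i> * of_real s)) has_integral W S) {0..S}"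
    "((\<lambda>S. Re (W S)) \<longlongrightarrow> - J) at_top"
proof -
  have "(F \<circ> sin) holomorphic_on UNIV"
    by (rule holomorphic_on_compose_gen[OF _ hol]) (auto intro: holomorphic_intros)
  then obtain G where "\<And>w. (G has_field_derivative F (sin w)) (at w)"
    using holomorphic_convex_primitive'[of UNIV "F \<circ> sin"] by auto
  note G = this and G_chain = DERIV_chain2[OF this]
  have Arcsin_G: "((\<lambda>z. G (Arcsin z)) has_field_derivative F z / csqrt (1 - z\<^sup>2)) (at z)"
    if "Im z = 0 \<Longrightarrow> \<bar>Re z\<bar> < 1" for z
  proof -
    have "((\<lambda>z. G (Arcsin z)) has_field_derivative F (sin (Arcsin z)) * inverse (cos (Arcsin z))) (at z)"
      using that by (intro G_chain has_field_derivative_Arcsin) auto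
    moreover have "cos (Arcsin z) = csqrt (1 - z\<^sup>2)"
    proof -
      have "\<i> * Arcsin z = Ln (\<i> * z + csqrt (1 - z\<^sup>2))"
        by (simp add: Arcsin_def)
      then have "exp (\<i> * Arcsin z) = \<i> * z + csqrt (1 - z\<^sup>2)"
        by (simp add: Arcsin_body_lemma)
      then show ?thesis by (simp add: exp_Euler)
    qed
    ultimately show ?thesis by (simp add: divide_inverse)
  qed
  have line: "((\<lambda>t. G (Arcsin (\<gamma> t))) has_vector_derivative \<gamma>' * (F (\<gamma> t) / csqrt (1 - (\<gamma> t)\<^sup>2))) (at t)"
    if "(\<gamma> has_vector_derivative \<gamma>') (at t)" "Im (\<gamma> t) = 0 \<Longrightarrow> \<bar>Re (\<gamma> t)\<bar> < 1" for \<gamma> \<gamma>' and t :: real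
    using field_vector_diff_chain_at[OF that(1) Arcsin_G[OF that(2)]] by (simp add: o_def)
  define W where "W S = G (Arcsin (1 + \<i> * of_real S)) - G (of_real (pi/2))" for S :: real
  have Arcsin_1: "Arcsin 1 = of_real (pi/2)"
    using of_real_arcsin[of 1] by simp
  have W: "((\<lambda>s. \<i> * F (1 + \<i> * of_real s) / csqrt ((of_real s)\<^sup>2 - 2 * \<i> * of_real s)) has_integral W S) {0..S}" if "S \<ge> 0" for S
  proof -
    have "((\<lambda>s. \<i> * F (1 + \<i> * of_real s) / csqrt ((of_real s)\<^sup>2 - 2 * \<i> * of_real s)) has_integral
            (G (Arcsin (1 + \<i> * of_real S)) - G (Arcsin (1 + \<i> * of_real 0)))) {0..S}"
    proof (rule fundamental_theorem_of_calculus_interior)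
      show "continuous_on {0..S} (\<lambda>s. G (Arcsin (1 + \<i> * of_real s)))"
      proof (intro continuous_at_imp_continuous_on ballI)
        fix s
        show "isCont (\<lambda>s. G (Arcsin (1 + \<i> * of_real s))) s"
          by (rule isCont_o2[OF isCont_Arcsin_1_plus_imag]) (use G in \<open>blast intro: DERIV_isCont\<close>)
      qed
      fix s assume "s \<in> {0<..<S}"
      then have "((\<lambda>s. G (Arcsin (1 + \<i> * of_real s))) has_vector_derivative
          \<i> * (F (1 + \<i> * of_real s) / csqrt (1 - (1 + \<i> * of_real s)\<^sup>2))) (at s)"
        by (intro line) (auto intro!: derivative_eq_intros)
      moreover have "1 - (1 + \<i> * of_real s)\<^sup>2 = (complex_of_real s)\<^sup>2 - 2 * \<i> * of_real s"
        by (simp add: power2_eq_square algebra_simps)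
      ultimately show "((\<lambda>s. G (Arcsin (1 + \<i> * of_real s))) has_vector_derivative
          \<i> * F (1 + \<i> * of_real s) / csqrt ((of_real s)\<^sup>2 - 2 * \<i> * of_real s)) (at s)"
        by simp
    qed (use that in auto)
    then show ?thesis by (simp add: W_def Arcsin_1)
  qed
  have imag_axis: "Re (G (Arcsin (\<i> * of_real S))) = Re (G 0)" for S :: real
  proof -
    have "((\<lambda>s. Re (G (Arcsin (\<i> * of_real s)))) has_real_derivative 0) (at s)" for s :: real
    proof -
      have "((\<lambda>s. G (Arcsin (\<i> * of_real s))) has_vector_derivative
          \<i> * (F (\<i> * of_real s) / csqrt (1 - (\<i> * of_real s)\<^sup>2))) (at s)"
        by (intro line) (auto intro!: derivative_eq_intros)
      then have "((\<lambda>s. Re (G (Arcsin (\<i> * of_real s)))) has_vector_derivative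
          Re (\<i> * (F (\<i> * of_real s) / csqrt (1 - (\<i> * of_real s)\<^sup>2)))) (at s)"
        by (rule bounded_linear.has_vector_derivative[OF bounded_linear_Re])
      moreover have "Re (\<i> * (F (\<i> * of_real s) / csqrt (1 - (\<i> * of_real s)\<^sup>2))) = 0"
      proof -
        have "1 - (\<i> * of_real s)\<^sup>2 = complex_of_real (1 + s\<^sup>2)"
          by (simp add: power_mult_distrib)
        moreover have "csqrt (complex_of_real (1 + s\<^sup>2)) = complex_of_real (sqrt (1 + s\<^sup>2))"
          by (rule of_real_sqrt[symmetric]) simp
        moreover have "F (\<i> * of_real s) = of_real (Re (F (\<i> * of_real s)))"
          using real_axis[of s] by (simp add: complex_eq_iff)
        ultimately have "F (\<i> * of_real s) / csqrt (1 - (\<i> * of_real s)\<^sup>2) = of_real (Re (F (\<i> * of_real s)) / sqrt (1 + s\<^sup>2))"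
          by (metis of_real_divide)
        then show ?thesis by simp
      qed
      ultimately show ?thesis
        by (simp add: has_real_derivative_iff_has_vector_derivative)
    qed
    then have "Re (G (Arcsin (\<i> * of_real S))) = Re (G (Arcsin (\<i> * of_real 0)))"
      using DERIV_isconst_all by blast
    then show ?thesis by simp
  qed
  \<comment> \<open>At height \<open>S\<close> the real part of \<open>1 - z\<^sup>2\<close> is at least \<open>S\<^sup>2\<close>.\<close>
  have segment: "norm (G (Arcsin (1 + \<i> * of_real S)) - G (Arcsin (\<i> * of_real S))) \<le> C / S" if "S > 0" for S :: real
  proof -
    have "norm (G (Arcsin (of_real 1 + \<i> * of_real S)) - G (Arcsin (of_real 0 + \<i> * of_real S))) \<le> C / S * 1 - C / S * 0"
    proof (rule norm_increment_bound)
      show "((\<lambda>u. G (Arcsin (of_real u + \<i> * of_real S))) has_vector_derivative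
          1 * (F (of_real u + \<i> * of_real S) / csqrt (1 - (of_real u + \<i> * of_real S)\<^sup>2))) (at u)" for u
        using that by (intro line) (auto intro!: derivative_eq_intros)
      show "((*) (C / S) has_real_derivative C / S) (at u)" for u
        using DERIV_cmult[OF DERIV_ident, of "C / S" u UNIV] by simp
      fix u :: real assume u: "0 < u" "u < 1"
      have "S\<^sup>2 \<le> Re (1 - (of_real u + \<i> * of_real S)\<^sup>2)"
        using u by (simp add: power2_eq_square mult_le_one)
      also have "\<dots> \<le> cmod (1 - (of_real u + \<i> * of_real S)\<^sup>2)"
        by (rule complex_Re_le_cmod)
      finally have "S \<le> sqrt (cmod (1 - (of_real u + \<i> * of_real S)\<^sup>2))"
        by (rule real_le_rsqrt)
      then show "norm (1 * (F (of_real u + \<i> * of_real S) / csqrt (1 - (of_real u + \<i> * of_real S)\<^sup>2))) \<le> C / S"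
        using bounded[of u S] that u by (auto simp: norm_divide intro!: frac_le order_trans[OF norm_ge_zero])
    qed simp
    then show ?thesis by simp
  qed
  have "((\<lambda>x. F (of_real (sin x))) has_integral (G (of_real (pi/2)) - G (of_real 0))) {0..pi/2}"
  proof (rule fundamental_theorem_of_calculus)
    fix x :: real
    have "((\<lambda>x. G (of_real x)) has_vector_derivative 1 * F (sin (of_real x))) (at x within {0..pi/2})"
      using field_vector_diff_chain_at[OF has_vector_derivative_of_real[OF DERIV_ident] G, of x]
      by (auto simp: o_def intro: has_vector_derivative_at_within)
    then show "((\<lambda>x. G (of_real x)) has_vector_derivative F (of_real (sin x))) (at x within {0..pi/2})"
      by (simp add: sin_of_real)
  qed simp
  from has_integral_linear[OF this bounded_linear_Re]
  have J_eq: "J = Re (G (of_real (pi/2))) - Re (G 0)"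
    using J by (simp add: o_def has_integral_iff)
  have "((\<lambda>S. Re (W S) + J) \<longlongrightarrow> 0) at_top"
  proof (rule Lim_null_comparison)
    show "((\<lambda>S. C / S) \<longlongrightarrow> 0) at_top"
      by (rule tendsto_divide_0[OF tendsto_const filterlim_at_top_imp_at_infinity[OF filterlim_ident]])
    show "\<forall>\<^sub>F S in at_top. norm (Re (W S) + J) \<le> C / S"
      using eventually_gt_at_top[of 0]
    proof eventually_elim
      case (elim S)
      have "Re (W S) + J = Re (G (Arcsin (1 + \<i> * of_real S)) - G (Arcsin (\<i> * of_real S)))"
        using imag_axis[of S] by (simp add: W_def J_eq)
      then show ?case
        using segment[OF elim] abs_Re_le_cmod by (metis order_trans real_norm_def)
    qed
  qed
  from tendsto_diff[OF this tendsto_const[of J]]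
  have "((\<lambda>S. Re (W S)) \<longlongrightarrow> - J) at_top" by simp
  with W that show ?thesis by blast
qed

section \<open>The amplitude on the ray\<close>

text \<open>
  The amplitude is \<open>exp (i s - s\<^sup>2/2) (1 + i s/2)\<^bsup>-1/2\<^esup>\<close>: the first factor stems from
  \<open>exp (t\<^sup>2/2)\<close> and the second from \<open>(1 + t)\<^bsup>-1/2\<^esup>\<close>, at \<open>t = 1 + i s\<close> and normalised to 1 at
  \<open>s = 0\<close>. Writing the root through \<open>Ln\<close> makes the logarithmic derivative and the modulus easy
  to read off.
\<close>

definition hankel_amplitude :: "real \<Rightarrow> complex" where
  "hankel_amplitude s = exp (\<i> * of_real s - (of_real s)\<^sup>2 / 2 - Ln (1 + \<i> * of_real s / 2) / 2)"

definition hankel_log_deriv :: "real \<Rightarrow> complex" where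
  "hankel_log_deriv s = \<i> - of_real s - \<i> / (4 + 2 * \<i> * of_real s)"

lemma hankel_amplitude_0 [simp]: "hankel_amplitude 0 = 1"
  by (simp add: hankel_amplitude_def)

lemma hankel_log_deriv_0 [simp]: "hankel_log_deriv 0 = 3 / 4 * \<i>"
  by (simp add: hankel_log_deriv_def)

lemma linear_phase_nonzero: "4 + 2 * \<i> * complex_of_real s \<noteq> 0" "1 + \<i> * complex_of_real s / 2 \<noteq> 0"
  by (simp_all add: complex_eq_iff)

lemma hankel_amplitude_deriv:
  "(hankel_amplitude has_vector_derivative hankel_log_deriv s * hankel_amplitude s) (at s)"
proof -
  have Ln: "((\<lambda>z. Ln (1 + \<i> * z / 2)) has_field_derivative inverse (1 + \<i> * z / 2) * (\<i> / 2)) (at z)"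
    if "z = complex_of_real s" for z
    using that by (intro DERIV_chain2[OF has_field_derivative_Ln])
      (auto intro!: derivative_eq_intros simp: complex_nonpos_Reals_iff)
  have "((\<lambda>z. \<i> * z - z\<^sup>2 / 2) has_field_derivative \<i> - z) (at z)" for z
    by (auto intro!: derivative_eq_intros)
  note DERIV_diff[OF this DERIV_cdivide[OF Ln[OF refl], of 2]]
  note DERIV_fun_exp[OF this]
  from field_vector_diff_chain_at[OF has_vector_derivative_of_real[OF DERIV_ident] this]
  have "(hankel_amplitude has_vector_derivative
      (\<i> - of_real s - (inverse (1 + \<i> * of_real s / 2) * (\<i> / 2)) / 2) * hankel_amplitude s) (at s)"
    by (simp add: o_def hankel_amplitude_def[abs_def] mult.commute)
  also have "\<i> - of_real s - (inverse (1 + \<i> * of_real s / 2) * (\<i> / 2)) / 2 = hankel_log_deriv s"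
  proof -
    have "4 + 2 * \<i> * complex_of_real s = 4 * (1 + \<i> * of_real s / 2)" by simp
    then show ?thesis unfolding hankel_log_deriv_def by (simp only: divide_inverse inverse_mult_distrib) simp
  qed
  finally show ?thesis .
qed

lemma hankel_log_deriv_deriv:
  "(hankel_log_deriv has_vector_derivative - 1 - 2 / (4 + 2 * \<i> * of_real s)\<^sup>2) (at s)"
proof -
  have "((\<lambda>z. \<i> - z - \<i> / (4 + 2 * \<i> * z)) has_field_derivative
      - 1 - (- (\<i> * (2 * \<i>)) / ((4 + 2 * \<i> * z) * (4 + 2 * \<i> * z)))) (at z)"
    if "z = complex_of_real s" for z
    using that linear_phase_nonzero[of s] by (auto intro!: derivative_eq_intros)
  from field_vector_diff_chain_at[OF has_vector_derivative_of_real[OF DERIV_ident] this[OF refl]]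
  have "(hankel_log_deriv has_vector_derivative
      - 1 - (- (\<i> * (2 * \<i>)) / ((4 + 2 * \<i> * of_real s) * (4 + 2 * \<i> * of_real s)))) (at s)"
    by (simp add: o_def hankel_log_deriv_def[abs_def])
  moreover have "\<i> * (2 * \<i>) = - 2" by (simp add: complex_eq_iff)
  ultimately show ?thesis by (simp add: power2_eq_square)
qed

lemma norm_hankel_amplitude: "norm (hankel_amplitude s) \<le> exp (- s\<^sup>2 / 2)"
proof -
  have "1 \<le> cmod (1 + \<i> * complex_of_real s / 2)"
    using complex_Re_le_cmod[of "1 + \<i> * complex_of_real s / 2"] by simp
  then have "Re (Ln (1 + \<i> * complex_of_real s / 2)) \<ge> 0"
    using linear_phase_nonzero(2)[of s] by simp
  moreover have "Re ((complex_of_real s)\<^sup>2) = s\<^sup>2" by (simp add: power2_eq_square)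
  ultimately show ?thesis by (simp add: hankel_amplitude_def)
qed

lemma norm_hankel_log_deriv: "(norm (hankel_log_deriv s))\<^sup>2 = 2 + s\<^sup>2 - 23 / 16 / (1 + s\<^sup>2 / 4)"
proof -
  define d e where "d = 1 + s\<^sup>2 / 4" and "e = 1 / d"
  have "d > 0" by (simp add: d_def add_pos_nonneg)
  then have de: "d * e = 1" by (simp add: e_def)
  have "\<i> = Complex (s * e / 8) (e / 4) * (4 + 2 * \<i> * of_real s)"
  proof (rule complex_eqI)
    have "Im (Complex (s * e / 8) (e / 4) * (4 + 2 * \<i> * of_real s)) = d * e"
      by (simp add: d_def power2_eq_square distrib_right)
    then show "Im \<i> = Im (Complex (s * e / 8) (e / 4) * (4 + 2 * \<i> * of_real s))"
      by (simp add: de)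
  qed simp
  then have "\<i> / (4 + 2 * \<i> * of_real s) = Complex (s * e / 8) (e / 4)"
    using linear_phase_nonzero(1)[of s] by (simp only: divide_eq_eq if_True simp_thms)
  then have "hankel_log_deriv s = Complex (- (s * (1 + e / 8))) (1 - e / 4)"
    unfolding hankel_log_deriv_def by (simp add: complex_eq_iff distrib_left)
  then have "(norm (hankel_log_deriv s))\<^sup>2 = s\<^sup>2 * (1 + e / 8)\<^sup>2 + (1 - e / 4)\<^sup>2"
    by (simp add: cmod_power2 power_mult_distrib)
  also have "s\<^sup>2 = 4 * (d - 1)" by (simp add: d_def)
  also have "4 * (d - 1) * (1 + e / 8)\<^sup>2 + (1 - e / 4)\<^sup>2
      = 2 + 4 * (d - 1) - 23 / 16 * e + (d * e - 1) * (1 + e / 16)"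
    by (simp add: power2_eq_square field_simps)
  also have "\<dots> = 2 + s\<^sup>2 - 23 / 16 / (1 + s\<^sup>2 / 4)"
    unfolding de by (simp add: d_def e_def)
  finally show ?thesis .
qed

lemma divide_1_plus_ge:
  fixes x c :: real assumes "x \<ge> 0" "c \<ge> 0" shows "c / (1 + x) \<ge> c * (1 - x)"
  using assms by (simp add: field_simps)

text \<open>
  By \<open>exp x \<ge> 1 + x + x\<^sup>2/2\<close> it suffices that a quadratic polynomial is nonnegative; the third
  hypothesis is the condition on its discriminant. The modulus of the amplitude decays like
  \<open>exp (- s\<^sup>2/2)\<close>, while the factors that arise by differentiation are bounded by linear
  functions of \<open>s\<^sup>2\<close>, so this provides bounds that are uniform on the whole ray.
\<close>

lemma quadratic_le_exp:
  fixes x :: real assumes "x \<ge> 0" "a \<le> c" "(b - c)\<^sup>2 \<le> 2 * c * (c - a)" "c > 0"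
  shows "(a + b * x) * exp (- x) \<le> c"
proof -
  have "0 \<le> (c * x + (c - b))\<^sup>2 + (2 * c * (c - a) - (b - c)\<^sup>2)"
    using assms(3) by simp
  also have "\<dots> = 2 * c * (c * (1 + x + x\<^sup>2 / 2) - (a + b * x))"
    by (simp add: power2_eq_square algebra_simps)
  finally have "a + b * x \<le> c * (1 + x + x\<^sup>2 / 2)"
    using \<open>c > 0\<close> by (simp add: zero_le_mult_iff)
  also have "\<dots> \<le> c * exp x"
    using assms exp_lower_Taylor_quadratic[of x] by simp
  finally show ?thesis by (simp add: exp_minus field_simps)
qed

lemma hankel_amplitude_deriv_bound:
  "norm (hankel_log_deriv s * hankel_amplitude s) \<le> 9 / 8"
proof (rule power2_le_imp_le)
  have "(norm (hankel_log_deriv s * hankel_amplitude s))\<^sup>2 = (norm (hankel_log_deriv s))\<^sup>2 * (norm (hankel_amplitude s))\<^sup>2"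
    by (simp add: norm_mult power_mult_distrib)
  also have "\<dots> \<le> (9 / 16 + 87 / 64 * s\<^sup>2) * (exp (- s\<^sup>2 / 2))\<^sup>2"
  proof (intro mult_mono power_mono norm_hankel_amplitude)
    show "(norm (hankel_log_deriv s))\<^sup>2 \<le> 9 / 16 + 87 / 64 * s\<^sup>2"
      using divide_1_plus_ge[of "s\<^sup>2 / 4" "23 / 16"] unfolding norm_hankel_log_deriv by simp
  qed auto
  also have "(exp (- s\<^sup>2 / 2))\<^sup>2 = exp (- s\<^sup>2)"
    by (simp flip: exp_double)
  also have "(9 / 16 + 87 / 64 * s\<^sup>2) * exp (- s\<^sup>2) \<le> 81 / 64"
    by (rule quadratic_le_exp) (simp_all add: power2_eq_square)
  finally show "(norm (hankel_log_deriv s * hankel_amplitude s))\<^sup>2 \<le> (9 / 8)\<^sup>2"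
    by (simp add: power2_eq_square)
qed simp

lemma hankel_amplitude_deriv2_bound:
  "norm (((hankel_log_deriv s)\<^sup>2 + (- 1 - 2 / (4 + 2 * \<i> * of_real s)\<^sup>2)) * hankel_amplitude s) \<le> 19 / 10"
proof -
  have D: "norm (4 + 2 * \<i> * complex_of_real s) ^ 2 = 16 * (1 + s\<^sup>2 / 4)"
    unfolding cmod_power2 by (simp add: power2_eq_square algebra_simps)
  have "norm ((hankel_log_deriv s)\<^sup>2 + (- 1 - 2 / (4 + 2 * \<i> * of_real s)\<^sup>2))
      \<le> (norm (hankel_log_deriv s))\<^sup>2 + (1 + norm (2 / (4 + 2 * \<i> * complex_of_real s)\<^sup>2))"
    by (intro order_trans[OF norm_triangle_ineq] add_mono order_trans[OF norm_triangle_ineq4])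
       (simp_all add: norm_power)
  also have "norm (2 / (4 + 2 * \<i> * complex_of_real s)\<^sup>2) = 1 / 8 / (1 + s\<^sup>2 / 4)"
  proof -
    have "2 / (16 * d) = 1 / 8 / d" for d :: real by simp
    then show ?thesis by (simp only: norm_divide norm_power D norm_numeral)
  qed
  also have "(norm (hankel_log_deriv s))\<^sup>2 + (1 + 1 / 8 / (1 + s\<^sup>2 / 4)) = 3 + s\<^sup>2 - 21 / 16 / (1 + s\<^sup>2 / 4)"
  proof -
    have "(2 + x - 23 / 16 * e) + (1 + 1 / 8 * e) = 3 + x - 21 / 16 * e" for x e :: real by simp
    from this[of "s\<^sup>2" "1 / (1 + s\<^sup>2 / 4)"] show ?thesis
      unfolding norm_hankel_log_deriv by (simp only: times_divide_eq_right mult_1_right)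
  qed
  also have "\<dots> \<le> 27 / 16 + 85 / 32 * (s\<^sup>2 / 2)"
    using divide_1_plus_ge[of "s\<^sup>2 / 4" "21 / 16"] by simp
  finally have 1: "norm ((hankel_log_deriv s)\<^sup>2 + (- 1 - 2 / (4 + 2 * \<i> * of_real s)\<^sup>2)) \<le> 27 / 16 + 85 / 32 * (s\<^sup>2 / 2)" .
  have "norm (((hankel_log_deriv s)\<^sup>2 + (- 1 - 2 / (4 + 2 * \<i> * of_real s)\<^sup>2)) * hankel_amplitude s)
      \<le> (27 / 16 + 85 / 32 * (s\<^sup>2 / 2)) * exp (- (s\<^sup>2 / 2))"
    unfolding norm_mult using norm_hankel_amplitude[of s] by (intro mult_mono 1) auto
  also have "\<dots> \<le> 19 / 10"
    by (rule quadratic_le_exp) (simp_all add: power2_eq_square)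
  finally show ?thesis .
qed

lemma hankel_amplitude_Taylor_1:
  assumes "s \<ge> 0"
  shows "norm (hankel_amplitude s - 1) \<le> 9 / 8 * s"
proof -
  have "norm (hankel_amplitude s - hankel_amplitude 0) \<le> 9 / 8 * s - 9 / 8 * 0"
  proof (rule norm_increment_bound[OF assms hankel_amplitude_deriv])
    show "((\<lambda>s. 9 / 8 * s) has_real_derivative 9 / 8) (at s)" for s :: real
      by (auto intro!: derivative_eq_intros)
  qed (rule hankel_amplitude_deriv_bound)
  then show ?thesis by simp
qed

text \<open>
  The linear coefficient is \<open>3/4 i = i - i/4\<close>, with \<open>i\<close> from the exponential and \<open>- i/4\<close> from
  the square root. The remainder constant is half the uniform bound \<open>19/10\<close> on the second derivative.
\<close>

lemma hankel_amplitude_Taylor_2: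
  assumes "s \<ge> 0"
  shows "norm (hankel_amplitude s - (1 + 3 / 4 * \<i> * of_real s)) \<le> 19 / 20 * s\<^sup>2"
proof -
  have d: "norm (hankel_log_deriv r * hankel_amplitude r - 3 / 4 * \<i>) \<le> 19 / 10 * r" if "r \<ge> 0" for r
  proof -
    have "norm (hankel_log_deriv r * hankel_amplitude r - hankel_log_deriv 0 * hankel_amplitude 0) \<le> 19 / 10 * r - 19 / 10 * 0"
    proof (rule norm_increment_bound[OF that])
      show "((\<lambda>s. 19 / 10 * s) has_real_derivative 19 / 10) (at s)" for s :: real
        by (auto intro!: derivative_eq_intros)
      fix s
      have "((\<lambda>s. hankel_log_deriv s * hankel_amplitude s) has_vector_derivative
          hankel_log_deriv s * (hankel_log_deriv s * hankel_amplitude s) + (- 1 - 2 / (4 + 2 * \<i> * of_real s)\<^sup>2) * hankel_amplitude s) (at s)"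
        by (rule has_vector_derivative_mult[OF hankel_log_deriv_deriv hankel_amplitude_deriv])
      then show "((\<lambda>s. hankel_log_deriv s * hankel_amplitude s) has_vector_derivative
          ((hankel_log_deriv s)\<^sup>2 + (- 1 - 2 / (4 + 2 * \<i> * of_real s)\<^sup>2)) * hankel_amplitude s) (at s)"
        by (simp add: power2_eq_square distrib_right mult.assoc)
    qed (rule hankel_amplitude_deriv2_bound)
    then show ?thesis by simp
  qed
  have "norm ((hankel_amplitude s - 3 / 4 * \<i> * of_real s) - (hankel_amplitude 0 - 3 / 4 * \<i> * of_real 0)) \<le> 19 / 20 * s\<^sup>2 - 19 / 20 * 0\<^sup>2"
  proof (rule norm_increment_bound[OF assms])
    show "((\<lambda>s. hankel_amplitude s - 3 / 4 * \<i> * of_real s) has_vector_derivative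
        hankel_log_deriv r * hankel_amplitude r - 3 / 4 * \<i>) (at r)" for r
      by (auto intro!: derivative_eq_intros hankel_amplitude_deriv)
    show "((\<lambda>s. 19 / 20 * s\<^sup>2) has_real_derivative 19 / 10 * r) (at r)" for r :: real
      by (auto intro!: derivative_eq_intros)
    show "norm (hankel_log_deriv r * hankel_amplitude r - 3 / 4 * \<i>) \<le> 19 / 10 * r" if "0 < r" for r
      using d that by simp
  qed
  then show ?thesis by (simp add: algebra_simps)
qed

text \<open>
  The amplitude that goes with the term \<open>t\<^sup>3 / (6 \<nu>) sin (\<nu> t)\<close>; because of the factor \<open>1 / \<nu>\<close>
  an expansion of order zero is enough.
\<close>

lemma hankel_amplitude_cubic_Taylor_1:
  assumes "s \<ge> 0"
  shows "norm (hankel_amplitude s * (1 + \<i> * of_real s) ^ 3 - 1) \<le> 33 / 8 * s"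
proof -
  have "(norm (3 * \<i> - 3 * of_real s - \<i> * (of_real s)\<^sup>2))\<^sup>2 = 9 + 3 * s\<^sup>2 + (s\<^sup>2)\<^sup>2"
    unfolding cmod_power2 by (simp add: power2_eq_square algebra_simps)
  also have "\<dots> \<le> 9 * (1 + s\<^sup>2 + (s\<^sup>2)\<^sup>2 / 2)"
  proof -
    have "9 + 3 * x + y \<le> 9 * (1 + x + y / 2)" if "x \<ge> 0" "y \<ge> 0" for x y :: real
      using that by (simp add: field_simps)
    from this[of "s\<^sup>2" "(s\<^sup>2)\<^sup>2"] show ?thesis by simp
  qed
  also have "\<dots> \<le> 9 * exp (s\<^sup>2)" using exp_lower_Taylor_quadratic[of "s\<^sup>2"] by simp
  also have "\<dots> = (3 * exp (s\<^sup>2 / 2))\<^sup>2"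
    by (simp add: power_mult_distrib flip: exp_double)
  finally have n3: "norm (3 * \<i> - 3 * of_real s - \<i> * (of_real s)\<^sup>2) \<le> 3 * exp (s\<^sup>2 / 2)"
    by (rule power2_le_imp_le) simp
  \<comment> \<open>The growth of the cubic factor is compensated by the decay of the amplitude.\<close>
  have eq: "(1 + \<i> * complex_of_real s) ^ 3 - 1 = of_real s * (3 * \<i> - 3 * of_real s - \<i> * (of_real s)\<^sup>2)"
    by (simp add: power2_eq_square power3_eq_cube algebra_simps)
  have "norm (hankel_amplitude s * ((1 + \<i> * of_real s) ^ 3 - 1))
      \<le> exp (- s\<^sup>2 / 2) * (s * (3 * exp (s\<^sup>2 / 2)))"
    unfolding eq norm_mult using assms by (intro mult_mono norm_hankel_amplitude n3) auto
  also have "\<dots> = 3 * s" by (simp add: exp_minus)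
  finally have 1: "norm (hankel_amplitude s * ((1 + \<i> * of_real s) ^ 3 - 1)) \<le> 3 * s" .
  have 2: "hankel_amplitude s * (1 + \<i> * of_real s) ^ 3 - 1
      = hankel_amplitude s * ((1 + \<i> * of_real s) ^ 3 - 1) + (hankel_amplitude s - 1)"
    by (simp add: algebra_simps)
  show ?thesis
    unfolding 2 by (rule order_trans[OF norm_triangle_ineq])
      (use add_mono[OF 1 hankel_amplitude_Taylor_1[OF assms]] in simp)
qed

text \<open>
  On the ray \<open>1 - t\<^sup>2 = s\<^sup>2 - 2 i s = - 2 i s (1 + i s/2)\<close>. The branches match, since the argument
  of the right-hand side lies strictly between \<open>- \<pi>/2\<close> and \<open>\<pi>/2\<close>; the phase \<open>- \<pi>/4\<close> of the
  asymptotic formula originates here.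
\<close>

lemma hankel_csqrt:
  assumes "s > 0"
  shows "csqrt ((of_real s)\<^sup>2 - 2 * \<i> * of_real s)
    = of_real (sqrt (2 * s)) * exp (- \<i> * of_real (pi / 4) + Ln (1 + \<i> * of_real s / 2) / 2)" (is "_ = ?w")
proof (rule csqrt_unique)
  have "(exp (- \<i> * of_real (pi / 4) + Ln (1 + \<i> * of_real s / 2) / 2))\<^sup>2
      = exp (- \<i> * of_real (pi / 2) + Ln (1 + \<i> * of_real s / 2))"
    unfolding exp_double[symmetric] by (rule arg_cong[of _ _ exp]) simp
  also have "\<dots> = exp (\<i> * of_real (- (pi / 2))) * exp (Ln (1 + \<i> * of_real s / 2))"
    by (simp flip: exp_add)
  also have "\<dots> = - \<i> * (1 + \<i> * of_real s / 2)"
    unfolding cis_conv_exp[symmetric] using linear_phase_nonzero(2)[of s] by simp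
  finally have "?w\<^sup>2 = of_real ((sqrt (2 * s))\<^sup>2) * (- \<i> * (1 + \<i> * of_real s / 2))"
    by (simp only: power_mult_distrib of_real_power)
  then show "?w\<^sup>2 = (of_real s)\<^sup>2 - 2 * \<i> * of_real s"
    using assms by (simp add: algebra_simps power2_eq_square)
  define \<alpha> where "\<alpha> = Im (Ln (1 + \<i> * complex_of_real s / 2))"
  have "\<bar>\<alpha>\<bar> < pi / 2" unfolding \<alpha>_def by (rule Re_Ln_pos_lt_imp) simp
  moreover have "0 \<le> \<alpha>"
    unfolding \<alpha>_def using assms Im_Ln_pos_le[OF linear_phase_nonzero(2)[of s]] by simp
  ultimately have "0 < cos (- (pi / 4) + \<alpha> / 2)"
    by (intro cos_gt_zero_pi) auto
  then have "0 < Re ?w"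
    using assms by (simp add: Re_exp \<alpha>_def[symmetric])
  then show "0 < Re ?w \<or> Re ?w = 0 \<and> 0 \<le> Im ?w" by blast
qed

section \<open>Truncated Gamma integrals\<close>

definition lower_gamma :: "real \<Rightarrow> real \<Rightarrow> real" where
  "lower_gamma a X = integral {0..X} (\<lambda>u. u powr (a - 1) / exp u)"

lemma lower_gamma_integrable:
  assumes "a > 0"
  shows "(\<lambda>u. u powr (a - 1) / exp u) integrable_on {0..X::real}"
  by (rule integrable_on_subinterval[OF has_integral_integrable[OF Gamma_integral_real[OF assms]]]) auto

lemma lower_gamma_le_Gamma:
  assumes "a > 0"
  shows "lower_gamma a X \<le> Gamma a"
proof -
  have "lower_gamma a X \<le> integral {0..} (\<lambda>u. u powr (a - 1) / exp u)"
    unfolding lower_gamma_def using Gamma_integral_real[OF assms] lower_gamma_integrable[OF assms]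
    by (intro integral_subset_le) auto
  then show ?thesis using Gamma_integral_real[OF assms] by (simp add: integral_unique)
qed

lemma lower_gamma_tendsto_Gamma:
  assumes "a > 0"
  shows "(lower_gamma a \<longlongrightarrow> Gamma a) at_top"
proof (rule tendstoI)
  fix e :: real assume "e > 0"
  with Gamma_integral_real[OF assms] obtain B where B: "B > 0"
    "\<And>a' b. ball 0 B \<subseteq> cbox a' b \<Longrightarrow>
      norm (integral (cbox a' b) (\<lambda>x. if x \<in> {0..} then x powr (a - 1) / exp x else 0) - Gamma a) < e"
    unfolding has_integral_alt' by blast
  show "\<forall>\<^sub>F X in at_top. dist (lower_gamma a X) (Gamma a) < e"
    using eventually_ge_at_top[of B]
  proof eventually_elim
    case (elim X)
    have "integral (cbox (-X) X) (\<lambda>x. if x \<in> {0..} then x powr (a - 1) / exp x else 0) = lower_gamma a X"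
    proof -
      have "{0..} \<inter> {-X..X} = {0..X}" using elim B(1) by auto
      then show ?thesis
        by (simp only: cbox_interval integral_restrict_Int lower_gamma_def)
    qed
    moreover have "ball 0 B \<subseteq> cbox (-X) X" using elim by (auto simp: dist_real_def)
    ultimately show ?case using B(2)[of "-X" X] by (simp add: dist_real_def)
  qed
qed

lemma has_integral_powr_exp_lower_gamma:
  assumes "a > 0" "\<nu> > 0" "S \<ge> 0"
  shows "((\<lambda>s. s powr (a - 1) * exp (- \<nu> * s)) has_integral lower_gamma a (\<nu> * S) / \<nu> powr a) {0..S}"
proof -
  have im: "(\<lambda>x. x / \<nu>) ` {0..\<nu> * S} = {0..S}"
    using assms by (simp add: image_divide_atLeastAtMost)
  have "((\<lambda>s. (\<nu> * s) powr (a - 1) / exp (\<nu> * s)) has_integral (1 / \<nu>) * lower_gamma a (\<nu> * S)) {0..S}"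
    using has_integral_stretch_real[OF integrable_integral[OF lower_gamma_integrable[OF \<open>a > 0\<close>, of "\<nu> * S"]], of \<nu>] assms im
    by (simp add: lower_gamma_def)
  from has_integral_mult_right[OF this, of "\<nu> powr (1 - a)"]
  have "((\<lambda>s. \<nu> powr (1 - a) * ((\<nu> * s) powr (a - 1) / exp (\<nu> * s))) has_integral \<nu> powr (1 - a) * ((1 / \<nu>) * lower_gamma a (\<nu> * S))) {0..S}" .
  moreover have "\<nu> powr (1 - a) * ((1 / \<nu>) * lower_gamma a (\<nu> * S)) = lower_gamma a (\<nu> * S) / \<nu> powr a"
    using assms by (simp add: powr_diff)
  moreover have "\<nu> powr (1 - a) * ((\<nu> * s) powr (a - 1) / exp (\<nu> * s)) = s powr (a - 1) * exp (- \<nu> * s)" if "s \<in> {0..S}" for s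
    using assms that by (simp add: powr_diff powr_mult exp_minus field_simps)
  ultimately show ?thesis
    using has_integral_eq[of "{0..S}" "\<lambda>s. \<nu> powr (1 - a) * ((\<nu> * s) powr (a - 1) / exp (\<nu> * s))" "\<lambda>s. s powr (a - 1) * exp (- \<nu> * s)"]
    by simp
qed

lemma Gamma_three_halves: "Gamma (3 / 2 :: real) = sqrt pi / 2"
proof -
  have "(1 / 2 :: real) \<notin> \<int>\<^sub>\<le>\<^sub>0" using nonpos_Ints_nonpos[of "1 / 2 :: real"] by auto
  then show ?thesis using Gamma_plus1[of "1 / 2 :: real"] by (simp add: Gamma_one_half_real)
qed

lemma Gamma_five_halves: "Gamma (5 / 2 :: real) = 3 / 4 * sqrt pi"
proof -
  have "(3 / 2 :: real) \<notin> \<int>\<^sub>\<le>\<^sub>0" using nonpos_Ints_nonpos[of "3 / 2 :: real"] by auto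
  then show ?thesis using Gamma_plus1[of "3 / 2 :: real"] by (simp add: Gamma_three_halves)
qed

section \<open>Asymptotics of the oscillatory integral\<close>

lemma cube_le_exp: "(x :: real) \<ge> 0 \<Longrightarrow> x ^ 3 \<le> 27 * exp x"
proof -
  assume "x \<ge> 0"
  then have "(x / 3) ^ 3 \<le> exp (x / 3) ^ 3"
    using exp_ge_add_one_self[of "x / 3"] by (intro power_mono) linarith+
  also have "\<dots> = exp x" by (simp flip: exp_of_nat_mult)
  finally show ?thesis by (simp add: power_divide)
qed

text \<open>
  The entire function \<open>F\<close> to which the shift of the path is applied.
\<close>

definition hermite_wave :: "real \<Rightarrow> complex \<Rightarrow> complex" where
  "hermite_wave \<nu> w = exp (w\<^sup>2 / 2 + \<i> * of_real \<nu> * w) * (1 - \<i> * w ^ 3 / of_real (6 * \<nu>))"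

lemma hermite_wave_real: "Re (hermite_wave \<nu> (of_real t)) = exp (t\<^sup>2 / 2) * hermite_approx \<nu> t"
proof -
  have "complex_of_real t ^ 3 = of_real (t ^ 3)" by simp
  then show ?thesis
    unfolding hermite_wave_def hermite_approx_def
    by (simp add: exp_add Re_divide Im_divide Re_exp Im_exp power2_eq_square algebra_simps del: of_real_power)
qed

text \<open>
  The correction term is odd in \<open>t\<close> and carries a factor \<open>i\<close>, so it is real on the imaginary axis
  just like the main term.
\<close>

lemma hermite_wave_imaginary: "Im (hermite_wave \<nu> (\<i> * of_real s)) = 0"
proof -
  have cube: "\<i> * (\<i> * complex_of_real s) ^ 3 = of_real (s ^ 3)"
    by (simp add: power3_eq_cube complex_eq_iff)
  have exponent: "(\<i> * complex_of_real s)\<^sup>2 / 2 + \<i> * of_real \<nu> * (\<i> * of_real s) = of_real (- s\<^sup>2 / 2 - \<nu> * s)"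
    by (simp add: power2_eq_square complex_eq_iff)
  have "hermite_wave \<nu> (\<i> * of_real s) = of_real (exp (- s\<^sup>2 / 2 - \<nu> * s) * (1 - s ^ 3 / (6 * \<nu>)))"
    unfolding hermite_wave_def cube exponent exp_of_real by simp
  then show ?thesis by simp
qed

lemma hermite_wave_bounded:
  assumes "\<nu> > 0" "0 \<le> u" "u \<le> 1" "0 \<le> s"
  shows "norm (hermite_wave \<nu> (of_real u + \<i> * of_real s)) \<le> exp (1 / 2) * (1 + 27 * exp (3 / 2) / (6 * \<nu>))"
proof -
  have "norm (of_real u + \<i> * complex_of_real s) \<le> 1 + s"
    using norm_triangle_ineq[of "of_real u" "\<i> * complex_of_real s"] assms by (simp add: norm_mult)
  then have "norm ((of_real u + \<i> * complex_of_real s) ^ 3) \<le> (1 + s) ^ 3"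
    unfolding norm_power by (intro power_mono) auto
  also have "\<dots> \<le> 27 * exp (1 + s)" using assms by (intro cube_le_exp) simp
  finally have cube: "norm ((of_real u + \<i> * complex_of_real s) ^ 3) \<le> 27 * exp (1 + s)" .
  have "norm (1 - \<i> * (of_real u + \<i> * of_real s) ^ 3 / of_real (6 * \<nu>)) \<le> 1 + 27 * exp (1 + s) / (6 * \<nu>)"
    by (rule order_trans[OF norm_triangle_ineq4])
       (use divide_right_mono[OF cube, of "6 * \<nu>"] assms in \<open>simp add: norm_divide norm_mult\<close>)
  moreover have "norm (exp ((of_real u + \<i> * complex_of_real s)\<^sup>2 / 2 + \<i> * of_real \<nu> * (of_real u + \<i> * of_real s)))
      \<le> exp (1 / 2 - s\<^sup>2 / 2)"
  proof -
    have "Re ((of_real u + \<i> * complex_of_real s)\<^sup>2 / 2 + \<i> * of_real \<nu> * (of_real u + \<i> * of_real s))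
        = u\<^sup>2 / 2 - s\<^sup>2 / 2 - \<nu> * s"
      by (simp add: power2_eq_square diff_divide_distrib)
    moreover have "u\<^sup>2 \<le> 1" using assms by (simp add: power_le_one)
    moreover have "\<nu> * s \<ge> 0" using assms by simp
    ultimately show ?thesis unfolding norm_exp_eq_Re by (simp only: exp_le_cancel_iff)
  qed
  ultimately have "norm (hermite_wave \<nu> (of_real u + \<i> * of_real s)) \<le> exp (1 / 2 - s\<^sup>2 / 2) * (1 + 27 * exp (1 + s) / (6 * \<nu>))"
    unfolding hermite_wave_def norm_mult by (intro mult_mono) auto
  also have "\<dots> = exp (1 / 2) * (exp (- s\<^sup>2 / 2) + 27 * exp (1 + s - s\<^sup>2 / 2) / (6 * \<nu>))"
  proof -
    have "exp (1 / 2 - s\<^sup>2 / 2) = exp (1 / 2) * exp (- s\<^sup>2 / 2)"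
      and e: "exp (1 + s - s\<^sup>2 / 2) = exp (- s\<^sup>2 / 2) * exp (1 + s)"
      by (simp_all flip: exp_add)
    then show ?thesis by (simp only: e) (simp add: algebra_simps)
  qed
  also have "\<dots> \<le> exp (1 / 2) * (1 + 27 * exp (3 / 2) / (6 * \<nu>))"
  proof -
    have "1 + s - s\<^sup>2 / 2 \<le> 3 / 2"
      using zero_le_power2[of "s - 1"] by (simp add: power2_eq_square algebra_simps)
    then show ?thesis
      using assms by (intro mult_left_mono add_mono divide_right_mono) auto
  qed
  finally show ?thesis .
qed

lemma hermite_wave_on_line:
  assumes "s > 0"
  shows "\<i> * hermite_wave \<nu> (1 + \<i> * of_real s) / csqrt ((of_real s)\<^sup>2 - 2 * \<i> * of_real s)
    = - of_real (sqrt (exp 1 / 2)) * cis (\<nu> - pi / 4) * of_real (s powr (- 1 / 2) * exp (- \<nu> * s))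
        * (hankel_amplitude s * (1 - \<i> * (1 + \<i> * of_real s) ^ 3 / of_real (6 * \<nu>)))"
proof -
  define L where "L = Ln (1 + \<i> * complex_of_real s / 2)"
  define k where "k = 1 - \<i> * (1 + \<i> * of_real s) ^ 3 / complex_of_real (6 * \<nu>)"
  have 1: "exp ((1 + \<i> * of_real s)\<^sup>2 / 2 + \<i> * of_real \<nu> * (1 + \<i> * of_real s))
      / exp (- \<i> * of_real (pi / 4) + L / 2)
    = of_real (exp (1 / 2)) * of_real (exp (- \<nu> * s)) * exp (\<i> * of_real (\<nu> + pi / 4)) * hankel_amplitude s"
    unfolding hankel_amplitude_def L_def[symmetric] exp_of_real[symmetric] exp_diff[symmetric] exp_add[symmetric]
    by (rule arg_cong[of _ _ exp]) (simp add: complex_eq_iff power2_eq_square field_simps)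
  have 2: "\<i> * exp (\<i> * of_real (\<nu> + pi / 4)) = - cis (\<nu> - pi / 4)"
  proof -
    have "\<i> * exp (\<i> * of_real (\<nu> + pi / 4)) = cis (pi / 2 + (\<nu> + pi / 4))"
      by (simp only: cis_conv_exp[symmetric] cis_mult[symmetric]) simp
    also have "pi / 2 + (\<nu> + pi / 4) = pi + (\<nu> - pi / 4)" by simp
    finally show ?thesis by (simp only: cis_mult[symmetric]) simp
  qed
  have 3: "1 / sqrt (2 * s) * exp (1 / 2) = sqrt (exp 1 / 2) * s powr (- 1 / 2)"
  proof -
    have "exp (1 / 2) = sqrt (exp 1 :: real)" by (rule real_sqrt_unique[symmetric]) (simp_all flip: exp_double)
    moreover have "s powr (- 1 / 2) = 1 / sqrt s"
      using assms powr_minus_divide[of s "1 / 2"] by (simp add: powr_half_sqrt)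
    ultimately show ?thesis
      by (simp add: real_sqrt_divide real_sqrt_mult)
  qed
  have "\<i> * hermite_wave \<nu> (1 + \<i> * of_real s) / csqrt ((of_real s)\<^sup>2 - 2 * \<i> * of_real s)
      = \<i> * (exp ((1 + \<i> * of_real s)\<^sup>2 / 2 + \<i> * of_real \<nu> * (1 + \<i> * of_real s))
          / exp (- \<i> * of_real (pi / 4) + L / 2)) * k * of_real (1 / sqrt (2 * s))"
    unfolding hankel_csqrt[OF assms] hermite_wave_def L_def k_def
    by (simp only: divide_inverse inverse_mult_distrib mult_ac of_real_mult of_real_inverse mult_1_left of_real_1)
  also have "\<dots> = (\<i> * exp (\<i> * of_real (\<nu> + pi / 4))) * of_real (1 / sqrt (2 * s) * exp (1 / 2)) * of_real (exp (- \<nu> * s)) * (hankel_amplitude s * k)"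
    unfolding 1 by (simp only: of_real_mult mult_ac)
  also have "\<dots> = - of_real (sqrt (exp 1 / 2)) * cis (\<nu> - pi / 4) * of_real (s powr (- 1 / 2) * exp (- \<nu> * s)) * (hankel_amplitude s * k)"
    unfolding 2 3 by (simp only: of_real_mult mult_ac mult_minus_left mult_minus_right)
  finally show ?thesis by (simp only: k_def)
qed

text \<open>
  The term with \<open>1 / \<nu>\<close> is kept to order zero only: its next term contributes at the order
  \<open>\<nu>\<^bsup>-5/2\<^esup>\<close>, like the quadratic remainder of the main amplitude.
\<close>

lemma wave_amplitude_Taylor:
  assumes "\<nu> > 0" "s \<ge> 0"
  shows "norm (hankel_amplitude s * (1 - \<i> * (1 + \<i> * of_real s) ^ 3 / of_real (6 * \<nu>))
      - (1 - \<i> / of_real (6 * \<nu>) + 3 / 4 * \<i> * of_real s)) \<le> 19 / 20 * s\<^sup>2 + 11 / 16 / \<nu> * s"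
proof -
  have "hankel_amplitude s * (1 - \<i> * (1 + \<i> * of_real s) ^ 3 / of_real (6 * \<nu>)) - (1 - \<i> / of_real (6 * \<nu>) + 3 / 4 * \<i> * of_real s)
      = (hankel_amplitude s - (1 + 3 / 4 * \<i> * of_real s)) - \<i> / of_real (6 * \<nu>) * (hankel_amplitude s * (1 + \<i> * of_real s) ^ 3 - 1)"
    by (simp add: algebra_simps)
  also have "norm \<dots> \<le> 19 / 20 * s\<^sup>2 + 1 / (6 * \<nu>) * (33 / 8 * s)"
  proof (rule order_trans[OF norm_triangle_ineq4], rule add_mono)
    show "norm (hankel_amplitude s - (1 + 3 / 4 * \<i> * of_real s)) \<le> 19 / 20 * s\<^sup>2"
      using assms by (intro hankel_amplitude_Taylor_2)
    have "norm (\<i> / complex_of_real (6 * \<nu>) * (hankel_amplitude s * (1 + \<i> * of_real s) ^ 3 - 1))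
        = 1 / (6 * \<nu>) * norm (hankel_amplitude s * (1 + \<i> * of_real s) ^ 3 - 1)"
      using assms by (simp add: norm_mult norm_divide)
    also have "\<dots> \<le> 1 / (6 * \<nu>) * (33 / 8 * s)"
      using assms by (intro mult_left_mono hankel_amplitude_cubic_Taylor_1) auto
    finally show "norm (\<i> / complex_of_real (6 * \<nu>) * (hankel_amplitude s * (1 + \<i> * of_real s) ^ 3 - 1)) \<le> 1 / (6 * \<nu>) * (33 / 8 * s)" .
  qed
  finally show ?thesis using assms by (simp add: field_simps)
qed

text \<open>
  Integrating the expanded amplitude against \<open>exp (- \<nu> s) s\<^bsup>-1/2\<^esup>\<close> produces
  \<open>\<Gamma>(1/2) \<nu>\<^bsup>-1/2\<^esup>\<close> and \<open>\<Gamma>(3/2) \<nu>\<^bsup>-3/2\<^esup>\<close>. The imaginary coefficient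
  \<open>3/4 \<cdot> 1/2 - 1/6 = 5/24\<close> becomes the coefficient of the sine, and the remainders sum to
  \<open>19/20 \<cdot> 3/4 + 11/16 \<cdot> 1/2 = 169/160\<close>. The integrals are truncated at \<open>S\<close>, with bounds
  independent of \<open>S\<close>, before \<open>S\<close> tends to infinity.
\<close>

proposition integral_hermite_approx_asymptotics:
  assumes "\<nu> > 0"
    and J: "((\<lambda>x. exp ((sin x)\<^sup>2 / 2) * hermite_approx \<nu> (sin x)) has_integral J) {0..pi/2}"
  shows "\<bar>J - sqrt (exp 1 / 2) * (sqrt pi / sqrt \<nu> * (cos (\<nu> - pi / 4) - 5 / 24 / \<nu> * sin (\<nu> - pi / 4)))\<bar>
    \<le> sqrt (exp 1 / 2) * (169 / 160 * (sqrt pi / sqrt \<nu>) / \<nu>\<^sup>2)"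
proof -
  define c where "c = sqrt (exp 1 / 2)"
  have "c > 0" by (simp add: c_def)
  define w where "w = cis (\<nu> - pi / 4)"
  define B where "B = 1 - \<i> / complex_of_real (6 * \<nu>)"
  define I where "I a S = lower_gamma a (\<nu> * S) / \<nu> powr a" for a S
  have I_int: "((\<lambda>s. s powr (a - 1) * exp (- \<nu> * s)) has_integral I a S) {0..S}" if "a > 0" "S \<ge> 0" for a S
    unfolding I_def using that assms by (intro has_integral_powr_exp_lower_gamma)
  have I_le: "I a S \<le> Gamma a / \<nu> powr a" if "a > 0" for a S
    unfolding I_def using that by (intro divide_right_mono lower_gamma_le_Gamma) auto
  have I_lim: "((\<lambda>S. I a S) \<longlongrightarrow> Gamma a / \<nu> powr a) at_top" if "a > 0" for a
    unfolding I_def using assms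
    by (intro tendsto_intros filterlim_compose[OF lower_gamma_tendsto_Gamma[OF that]]
          filterlim_tendsto_pos_mult_at_top[OF tendsto_const _ filterlim_ident]) auto
  obtain W where W: "\<And>S. S \<ge> 0 \<Longrightarrow> ((\<lambda>s. \<i> * hermite_wave \<nu> (1 + \<i> * of_real s) / csqrt ((of_real s)\<^sup>2 - 2 * \<i> * of_real s)) has_integral W S) {0..S}"
    and W_lim: "((\<lambda>S. Re (W S)) \<longlongrightarrow> - J) at_top"
  proof (rule quarter_strip_contour_shift)
    show "hermite_wave \<nu> holomorphic_on UNIV"
      unfolding hermite_wave_def using assms by (intro holomorphic_intros) auto
    show "((\<lambda>x. Re (hermite_wave \<nu> (of_real (sin x)))) has_integral J) {0..pi/2}"
      using J by (simp only: hermite_wave_real)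
  qed (use hermite_wave_imaginary hermite_wave_bounded[OF \<open>\<nu> > 0\<close>] in blast)+
  define M where "M S = - of_real c * w * (of_real (I (1/2) S) * B + of_real (I (3/2) S) * (3 / 4 * \<i>))" for S
  have close: "norm (W S - M S) \<le> c * (19 / 20 * (Gamma (5/2) / \<nu> powr (5/2)) + 11 / 16 / \<nu> * (Gamma (3/2) / \<nu> powr (3/2)))"
    if "S \<ge> 0" for S
  proof -
    define g where "g s = \<i> * hermite_wave \<nu> (1 + \<i> * of_real s) / csqrt ((of_real s)\<^sup>2 - 2 * \<i> * of_real s)" for s
    define m where "m s = - of_real c * w * (of_real (s powr (1/2 - 1) * exp (- \<nu> * s)) * B + of_real (s powr (3/2 - 1) * exp (- \<nu> * s)) * (3 / 4 * \<i>))" for s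
    define b where "b s = c * (19 / 20 * (s powr (5/2 - 1) * exp (- \<nu> * s)) + 11 / 16 / \<nu> * (s powr (3/2 - 1) * exp (- \<nu> * s)))" for s
    have g: "(g has_integral W S) {0..S}" unfolding g_def using W that by simp
    have m: "(m has_integral M S) {0..S}"
      unfolding m_def M_def
      by (intro has_integral_mult_right has_integral_add has_integral_mult_left has_integral_of_real I_int that) auto
    have b: "(b has_integral c * (19 / 20 * I (5/2) S + 11 / 16 / \<nu> * I (3/2) S)) {0..S}"
      unfolding b_def by (intro has_integral_mult_right has_integral_add I_int that) auto
    \<comment> \<open>At \<open>s = 0\<close> all three functions vanish, by \<open>x / 0 = 0\<close> and \<open>0 powr a = 0\<close>.\<close>
    have "norm (g s - m s) \<le> b s" if "s \<in> {0..S}" for s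
    proof (cases "s = 0")
      case True
      then show ?thesis by (simp add: g_def m_def b_def)
    next
      case False
      then have s: "s > 0" using that by simp
      have p: "s powr (3/2 - 1) = s powr (- 1/2) * s" "s powr (5/2 - 1) = s powr (- 1/2) * s\<^sup>2" "s powr (1/2 - 1) = s powr (- 1/2)"
        using s powr_add[of s "- 1/2" 1] powr_add[of s "- 1/2" 2] by (simp_all add: powr_numeral)
      define E where "E = s powr (- 1/2) * exp (- \<nu> * s)"
      have "E \<ge> 0" by (simp add: E_def)
      define A where "A = hankel_amplitude s * (1 - \<i> * (1 + \<i> * of_real s) ^ 3 / of_real (6 * \<nu>))"
      have gA: "g s = - of_real c * w * of_real E * A"
        unfolding g_def hermite_wave_on_line[OF s] c_def w_def E_def A_def ..
      have mA: "m s = - of_real c * w * of_real E * (B + 3 / 4 * \<i> * of_real s)"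
        unfolding m_def p E_def by (simp add: algebra_simps)
      have "g s - m s = - of_real c * w * of_real E * (A - (B + 3 / 4 * \<i> * of_real s))"
        unfolding gA mA by (simp only: right_diff_distrib)
      then have "norm (g s - m s) = c * E * norm (A - (B + 3 / 4 * \<i> * of_real s))"
        using \<open>c > 0\<close> \<open>E \<ge> 0\<close> by (simp add: norm_mult w_def)
      also have "\<dots> \<le> c * E * (19 / 20 * s\<^sup>2 + 11 / 16 / \<nu> * s)"
        unfolding A_def B_def using \<open>c > 0\<close> \<open>E \<ge> 0\<close> assms s
        by (intro mult_left_mono wave_amplitude_Taylor) auto
      also have "\<dots> = b s"
        unfolding b_def p E_def by (simp add: algebra_simps)
      finally show ?thesis .
    qed
    then have "norm (W S - M S) \<le> c * (19 / 20 * I (5/2) S + 11 / 16 / \<nu> * I (3/2) S)"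
      using integral_norm_bound_integral[of "\<lambda>s. g s - m s" "{0..S}" b] has_integral_diff[OF g m] b
      by (auto simp: has_integral_iff)
    also have "\<dots> \<le> c * (19 / 20 * (Gamma (5/2) / \<nu> powr (5/2)) + 11 / 16 / \<nu> * (Gamma (3/2) / \<nu> powr (3/2)))"
      using \<open>c > 0\<close> assms by (intro mult_left_mono add_mono I_le) auto
    finally show ?thesis .
  qed
  define Minf where "Minf = - of_real c * w * (of_real (Gamma (1/2) / \<nu> powr (1/2)) * B + of_real (Gamma (3/2) / \<nu> powr (3/2)) * (3 / 4 * \<i>))"
  have "(M \<longlongrightarrow> Minf) at_top"
    unfolding M_def Minf_def by (intro tendsto_intros I_lim) auto
  then have "((\<lambda>S. \<bar>Re (W S) - Re (M S)\<bar>) \<longlongrightarrow> \<bar>- J - Re Minf\<bar>) at_top"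
    by (intro tendsto_intros W_lim)
  moreover have "\<forall>\<^sub>F S in at_top. \<bar>Re (W S) - Re (M S)\<bar>
      \<le> c * (19 / 20 * (Gamma (5/2) / \<nu> powr (5/2)) + 11 / 16 / \<nu> * (Gamma (3/2) / \<nu> powr (3/2)))"
    using eventually_ge_at_top[of 0]
  proof eventually_elim
    case (elim S)
    have "\<bar>Re (W S) - Re (M S)\<bar> \<le> norm (W S - M S)" using abs_Re_le_cmod[of "W S - M S"] by simp
    also note close[OF elim]
    finally show ?case .
  qed
  ultimately have "\<bar>- J - Re Minf\<bar> \<le> c * (19 / 20 * (Gamma (5/2) / \<nu> powr (5/2)) + 11 / 16 / \<nu> * (Gamma (3/2) / \<nu> powr (3/2)))"
    by (rule tendsto_upperbound) simp
  moreover have p: "\<nu> powr (1/2) = sqrt \<nu>" "\<nu> powr (3/2) = sqrt \<nu> * \<nu>" "\<nu> powr (5/2) = sqrt \<nu> * \<nu>\<^sup>2"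
    using assms powr_add[of \<nu> "1/2" 1] powr_add[of \<nu> "1/2" 2] by (simp_all add: powr_numeral powr_half_sqrt)
  moreover have "19 / 20 * (Gamma (5/2) / \<nu> powr (5/2)) + 11 / 16 / \<nu> * (Gamma (3/2) / \<nu> powr (3/2))
      = 169 / 160 * (sqrt pi / sqrt \<nu>) / \<nu>\<^sup>2"
    unfolding p Gamma_three_halves Gamma_five_halves using assms by (simp add: field_simps power2_eq_square)
  moreover have "Re Minf = - (c * (sqrt pi / sqrt \<nu> * (cos (\<nu> - pi / 4) - 5 / 24 / \<nu> * sin (\<nu> - pi / 4))))"
  proof -
    define r where "r = sqrt pi / sqrt \<nu>"
    have 1: "Gamma (1/2) / \<nu> powr (1/2) = r" "Gamma (3/2) / \<nu> powr (3/2) = r / (2 * \<nu>)"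
      unfolding p Gamma_three_halves Gamma_one_half_real r_def by simp_all
    have "of_real r * B + of_real (r / (2 * \<nu>)) * (3 / 4 * \<i>) = Complex r (r * (5 / 24 / \<nu>))"
      unfolding B_def using assms by (simp add: complex_eq_iff Im_divide power2_eq_square field_simps)
    then show ?thesis
      unfolding Minf_def 1 r_def[symmetric] w_def by (simp add: algebra_simps)
  qed
  ultimately show ?thesis unfolding c_def by simp
qed

section \<open>From the frequency to the square root of the degree\<close>

lemma abs_sin_add_diff_le:
  fixes x s :: real
  assumes "s \<ge> 0"
  shows "\<bar>sin (x + s) - sin x\<bar> \<le> s"
proof -
  have "norm (sin (x + s) - sin (x + 0)) \<le> s - 0"
  proof (rule norm_increment_bound[OF assms])
    show "((\<lambda>s. sin (x + s)) has_vector_derivative cos (x + r)) (at r)" for r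
      unfolding has_real_derivative_iff_has_vector_derivative[symmetric]
      by (auto intro!: derivative_eq_intros)
    show "((\<lambda>s. s) has_real_derivative 1) (at r)" for r :: real by (rule DERIV_ident)
  qed simp
  then show ?thesis by simp
qed

lemma cos_add_Taylor:
  fixes x s :: real
  assumes "s \<ge> 0"
  shows "\<bar>cos (x + s) - cos x + s * sin x\<bar> \<le> s\<^sup>2 / 2"
proof -
  have "norm ((cos (x + s) + s * sin x) - (cos (x + 0) + 0 * sin x)) \<le> s\<^sup>2 / 2 - 0\<^sup>2 / 2"
  proof (rule norm_increment_bound[OF assms])
    show "((\<lambda>s. cos (x + s) + s * sin x) has_vector_derivative sin x - sin (x + r)) (at r)" for r
      unfolding has_real_derivative_iff_has_vector_derivative[symmetric]
      by (auto intro!: derivative_eq_intros)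
    show "((\<lambda>s. s\<^sup>2 / 2) has_real_derivative r) (at r)" for r :: real
      by (auto intro!: derivative_eq_intros)
    show "norm (sin x - sin (x + r)) \<le> r" if "0 < r" for r
      using abs_sin_add_diff_le[of r x] that by (simp add: abs_minus_commute)
  qed
  then show ?thesis by (simp add: algebra_simps)
qed

text \<open>
  With \<open>r = sqrt n\<close>, the shift \<open>\<delta> = \<nu> - 2 r = 1 / (\<nu> + 2 r)\<close> is \<open>1 / (4 r)\<close> up to \<open>O(r\<^bsup>-3\<^esup>)\<close>, and
  the ratio \<open>c\<close> of the amplitudes \<open>sqrt (2 / \<nu>)\<close> and \<open>n\<^bsup>-1/4\<^esup>\<close> is \<open>1 - O(1/n)\<close>. After
  multiplication by \<open>n\<^bsup>1/4\<^esup>\<close> the difference splits into five terms, each \<open>O(1/n)\<close>: the ratio of the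
  amplitudes, the Taylor remainder of the cosine, the error in the size of the shift, and for
  the sine term the shift of the phase and the change of the amplitude.
\<close>

lemma phase_change:
  fixes n :: nat
  assumes "n \<ge> 1"
  defines "\<nu> \<equiv> sqrt (4 * real n + 1)"
  defines "\<omega> \<equiv> 2 * sqrt (real n) - pi / 4"
  shows "\<bar>sqrt (2 / \<nu>) * (cos (\<nu> - pi / 4) - 5 / 24 / \<nu> * sin (\<nu> - pi / 4))
    - (cos \<omega> / real n powr (1 / 4) - 17 / 48 * (sin \<omega> / real n powr (3 / 4)))\<bar> \<le> 161 / 1000 / real n"
proof -
  define r where "r = sqrt (real n)"
  define a where "a = sqrt r"
  define c where "c = sqrt (2 * r / \<nu>)"
  define \<delta> where "\<delta> = \<nu> - 2 * r"
  have r: "r \<ge> 1" "r * r = real n" using assms by (simp_all add: r_def)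
  have a: "a \<ge> 1" "a * a = r" using r by (simp_all add: a_def)
  have \<nu>2: "\<nu> * \<nu> = 4 * (r * r) + 1" by (simp add: \<nu>_def r)
  have "2 * r < \<nu>"
    unfolding \<nu>_def using r by (intro real_less_rsqrt) (simp add: power2_eq_square)
  then have \<delta>0: "\<delta> > 0" and \<nu>0: "\<nu> > 0" using r by (simp_all add: \<delta>_def)
  have \<delta>_eq: "\<delta> * (\<nu> + 2 * r) = 1" using \<nu>2 by (simp add: \<delta>_def algebra_simps)
  have "\<delta> * (4 * r) \<le> \<delta> * (\<nu> + 2 * r)"
    using \<delta>0 \<open>2 * r < \<nu>\<close> by (intro mult_left_mono) auto
  then have \<delta>_le: "\<delta> \<le> 1 / (4 * r)" using \<delta>_eq r by (simp add: field_simps)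
  have \<delta>2: "\<delta>\<^sup>2 \<le> 1 / (16 * real n)"
    using power_mono[OF \<delta>_le, of 2] \<delta>0 r by (simp add: power_divide power2_eq_square)
  have \<delta>_ge: "1 / (4 * r) - \<delta> = \<delta>\<^sup>2 / (4 * r)"
  proof -
    have "1 / (4 * r) - \<delta> = (\<delta> * (\<nu> + 2 * r) - \<delta> * (4 * r)) / (4 * r)"
      unfolding \<delta>_eq using r by (simp add: diff_divide_distrib)
    also have "\<delta> * (\<nu> + 2 * r) - \<delta> * (4 * r) = \<delta>\<^sup>2"
      by (simp add: \<delta>_def power2_eq_square algebra_simps)
    finally show ?thesis .
  qed
  have c2: "c * c = 2 * r / \<nu>" using r \<nu>0 by (simp add: c_def)
  have c0: "c > 0" using r \<nu>0 by (simp add: c_def)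
  have "1 - c * c = \<delta> / \<nu>" using \<nu>0 by (simp add: c2 \<delta>_def diff_divide_distrib)
  also have "\<dots> \<le> (1 / (4 * r)) / (2 * r)"
    using \<delta>_le \<delta>0 \<open>2 * r < \<nu>\<close> r by (intro frac_le) auto
  finally have cc: "1 - c * c \<le> 1 / (8 * real n)" by (simp flip: r(2))
  have c1: "c < 1"
    using \<open>2 * r < \<nu>\<close> \<nu>0 r by (simp add: c_def)
  have c_ge: "c \<ge> 7 / 8"
  proof -
    have "1 / (8 * real n) \<le> 1 / 8" using assms by simp
    moreover have "c * c \<le> c" using c0 c1 by simp
    ultimately show ?thesis using cc by linarith
  qed
  have c_diff: "1 - c \<le> 1 / 15 / real n"
  proof -
    have "(1 - c) * (15 / 8) \<le> (1 - c) * (1 + c)"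
      using c1 c_ge by (intro mult_left_mono) auto
    also have "\<dots> \<le> 1 / (8 * real n)" using cc by (simp add: algebra_simps)
    finally show ?thesis using assms by (simp add: field_simps)
  qed
  have c3: "1 - c ^ 3 \<le> 1 / 5 / real n"
  proof -
    have "1 - c ^ 3 = (1 - c) * (1 + c + c * c)" by (simp add: power3_eq_cube algebra_simps)
    also have "\<dots> \<le> (1 / 15 / real n) * 3"
      using c_diff c0 c1 mult_le_one[of c c] by (intro mult_mono) auto
    finally show ?thesis by simp
  qed
  have c31: "c ^ 3 \<le> 1" using c0 c1 by (intro power_le_one) auto
  have inv_n: "1 / real n \<ge> 0" by simp
  have a_powr: "real n powr (1 / 4) = a" "real n powr (3 / 4) = a * r"
  proof -
    have "real n powr (1 / 2) = r" using assms by (simp add: r_def powr_half_sqrt)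
    moreover have "(real n powr (1 / 2)) powr (1 / 2) = real n powr (1 / 4)" by (simp add: powr_powr)
    ultimately show 1: "real n powr (1 / 4) = a" using r by (simp add: a_def powr_half_sqrt)
    show "real n powr (3 / 4) = a * r"
      using powr_add[of "real n" "1 / 4" "1 / 2"] 1 \<open>real n powr (1 / 2) = r\<close> by simp
  qed
  have amp: "sqrt (2 / \<nu>) = c / a"
    using r(1) by (simp add: c_def a_def real_sqrt_divide real_sqrt_mult)
  \<comment> \<open>Since \<open>2 r = c\<^sup>2 \<nu>\<close>; this exhibits \<open>5/24 \<cdot> c / \<nu>\<close> as \<open>5/48 \<cdot> c\<^sup>3 / r\<close>.\<close>
  have c\<nu>: "c / \<nu> = c ^ 3 / (2 * r)"
    using r(1) \<nu>0 by (simp add: power3_eq_cube c2)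
  have shift: "\<nu> - pi / 4 = \<omega> + \<delta>" by (simp add: \<omega>_def \<delta>_def r_def)
  \<comment> \<open>The sine coefficient is decomposed as \<open>17/48 = 12/48 + 5/48\<close>: the first part cancels
    the linear term of the phase shift, the second the sine term of the amplitude.\<close>
  define T1 where "T1 = (c - 1) * cos (\<omega> + \<delta>)"
  define T2 where "T2 = cos (\<omega> + \<delta>) - cos \<omega> + \<delta> * sin \<omega>"
  define T3 where "T3 = \<delta>\<^sup>2 / (4 * r) * sin \<omega>"
  define T4 where "T4 = 5 / 48 / r * (sin \<omega> - sin (\<omega> + \<delta>))"
  define T5 where "T5 = 5 / 48 / r * (1 - c ^ 3) * sin (\<omega> + \<delta>)"
  have "sqrt (2 / \<nu>) * (cos (\<nu> - pi / 4) - 5 / 24 / \<nu> * sin (\<nu> - pi / 4))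
      - (cos \<omega> / real n powr (1 / 4) - 17 / 48 * (sin \<omega> / real n powr (3 / 4)))
    = (c * cos (\<omega> + \<delta>) - 5 / 24 * (c / \<nu>) * sin (\<omega> + \<delta>) - cos \<omega> + 17 / 48 * (1 / r) * sin \<omega>) / a"
    unfolding a_powr amp shift
  proof -
    have "(c / a) * (x - 5 / 24 / \<nu> * y) - (u / a - 17 / 48 * (v / (a * r)))
        = (c * x - 5 / 24 * (c / \<nu>) * y - u + 17 / 48 * (1 / r) * v) / a"
      if "a \<noteq> 0" "r \<noteq> 0" "\<nu> \<noteq> 0" for x y u v
      using that by (simp add: field_simps)
    then show "(c / a) * (cos (\<omega> + \<delta>) - 5 / 24 / \<nu> * sin (\<omega> + \<delta>))
        - (cos \<omega> / a - 17 / 48 * (sin \<omega> / (a * r)))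
      = (c * cos (\<omega> + \<delta>) - 5 / 24 * (c / \<nu>) * sin (\<omega> + \<delta>) - cos \<omega> + 17 / 48 * (1 / r) * sin \<omega>) / a"
      using a(1) r(1) \<nu>0 by (metis less_irrefl not_one_le_zero)
  qed
  also have "c * cos (\<omega> + \<delta>) - 5 / 24 * (c / \<nu>) * sin (\<omega> + \<delta>) - cos \<omega> + 17 / 48 * (1 / r) * sin \<omega>
      = T1 + T2 + T3 + T4 + T5"
    unfolding c\<nu> T1_def T2_def T3_def T4_def T5_def \<delta>_ge[symmetric]
    by (simp add: ring_distribs diff_divide_distrib add_divide_distrib)
  finally have eq: "sqrt (2 / \<nu>) * (cos (\<nu> - pi / 4) - 5 / 24 / \<nu> * sin (\<nu> - pi / 4))
      - (cos \<omega> / real n powr (1 / 4) - 17 / 48 * (sin \<omega> / real n powr (3 / 4))) = (T1 + T2 + T3 + T4 + T5) / a" .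
  have "\<bar>T1\<bar> \<le> 1 / 15 / real n"
  proof -
    have "\<bar>T1\<bar> \<le> (1 - c) * 1" unfolding T1_def abs_mult using c1 by (intro mult_mono) auto
    with c_diff show ?thesis by simp
  qed
  moreover have "\<bar>T2\<bar> \<le> 1 / 32 / real n"
    unfolding T2_def using cos_add_Taylor[of \<delta> \<omega>] \<delta>0 \<delta>2 by (simp add: field_simps)
  moreover have "\<bar>T3\<bar> \<le> 1 / 64 / real n"
  proof -
    have "\<bar>T3\<bar> \<le> \<delta>\<^sup>2 / (4 * r) * 1"
      unfolding T3_def abs_mult using r by (intro mult_mono) auto
    also have "\<dots> \<le> (1 / (16 * real n)) / 4"
      using \<delta>2 r by (simp only: mult_1_right, intro frac_le) auto
    finally show ?thesis by simp
  qed
  moreover have "\<bar>T4\<bar> \<le> 5 / 192 / real n"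
  proof -
    have "\<bar>T4\<bar> \<le> 5 / 48 / r * (1 / (4 * r))"
      unfolding T4_def abs_mult using abs_sin_add_diff_le[of \<delta> \<omega>] \<delta>0 \<delta>_le r
      by (intro mult_mono) (auto simp: abs_minus_commute)
    then show ?thesis by (simp flip: r(2))
  qed
  moreover have "\<bar>T5\<bar> \<le> 1 / 48 / real n"
  proof -
    have "\<bar>T5\<bar> \<le> 5 / 48 / r * (1 - c ^ 3) * 1"
      unfolding T5_def abs_mult using c31 r by (intro mult_mono) auto
    also have "\<dots> \<le> 5 / 48 / 1 * (1 / 5 / real n) * 1"
      using c3 c31 r by (intro mult_mono frac_le) auto
    finally show ?thesis by simp
  qed
  ultimately have "\<bar>T1 + T2 + T3 + T4 + T5\<bar>
      \<le> 1 / 15 / real n + 1 / 32 / real n + 1 / 64 / real n + 5 / 192 / real n + 1 / 48 / real n"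
    by (intro order_trans[OF abs_triangle_ineq] add_mono)
  also have "\<dots> = (1/15 + 1/32 + 1/64 + 5/192 + 1/48) * (1 / real n)"
    by (simp only: add_divide_distrib times_divide_eq_right mult_1_right)
  also have "\<dots> \<le> 161 / 1000 * (1 / real n)" using inv_n by (intro mult_right_mono) auto
  finally have T: "\<bar>T1 + T2 + T3 + T4 + T5\<bar> \<le> 161 / 1000 / real n" by simp
  have "\<bar>(T1 + T2 + T3 + T4 + T5) / a\<bar> \<le> \<bar>T1 + T2 + T3 + T4 + T5\<bar>"
    using a(1) divide_left_mono[of 1 a "\<bar>T1 + T2 + T3 + T4 + T5\<bar>"] by (simp add: abs_divide)
  with T show ?thesis unfolding eq by linarith
qed

section \<open>The asymptotic formula\<close>

text \<open>
  The error \<open>59/100 t\<^sup>2 / \<nu>\<^sup>2\<close> of the approximate Hermite function is averaged against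
  \<open>exp (t\<^sup>2/2) \<le> 1 + 3/4 t\<^sup>2\<close>. The means of \<open>t\<^sup>2\<close> and \<open>t\<^sup>4\<close> for \<open>t = sin x\<close> are \<open>1/2\<close> and
  \<open>3/8\<close>, which gives \<open>59/100 \<cdot> 25/32 < 47/100\<close>.
\<close>

proposition laguerre_at_1_asymptotics:
  fixes n :: nat
  assumes "n \<ge> 1"
  defines "\<nu> \<equiv> sqrt (4 * real n + 1)"
  shows "\<bar>laguerre_at_1 n - sqrt (exp 1 / pi) * (sqrt (2 / \<nu>) * (cos (\<nu> - pi / 4) - 5 / 24 / \<nu> * sin (\<nu> - pi / 4)))\<bar>
    \<le> (sqrt (exp 1 / pi) * (169 / 160 * sqrt (2 / \<nu>)) + 47 / 100) / \<nu>\<^sup>2"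
proof -
  have \<nu>: "\<nu> > 0" by (simp add: \<nu>_def)
  let ?h = "\<lambda>x. exp ((sin x)\<^sup>2 / 2) * hermite_approx \<nu> (sin x)"
  have "continuous_on {0..pi/2} ?h"
    unfolding hermite_approx_def using \<nu> by (intro continuous_intros) auto
  then obtain J where J: "(?h has_integral J) {0..pi/2}"
    using integrable_continuous_interval by blast
  have bound: "((\<lambda>x. 59 / 100 / \<nu>\<^sup>2 * (sin x ^ (2 * 1) + 3 / 4 * sin x ^ (2 * 2))) has_integral
      59 / 100 / \<nu>\<^sup>2 * (pi / 2 * (fact (2 * 1) / (4 ^ 1 * (fact 1)\<^sup>2)) + 3 / 4 * (pi / 2 * (fact (2 * 2) / (4 ^ 2 * (fact 2)\<^sup>2))))) {0..pi/2}"
    by (intro has_integral_mult_right has_integral_add has_integral_sin_even_power)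
  have "norm (even_hermite n (sin x) - ?h x) \<le> 59 / 100 / \<nu>\<^sup>2 * (sin x ^ (2 * 1) + 3 / 4 * sin x ^ (2 * 2))"
    if "x \<in> {0..pi/2}" for x
  proof -
    define t where "t = sin x"
    have t: "0 \<le> t" "t \<le> 1" using that by (auto simp: t_def intro: sin_ge_zero)
    then have t2: "t\<^sup>2 \<le> 1" by (simp add: power_le_one)
    have "exp (t\<^sup>2 / 2) * exp (- t\<^sup>2 / 2) = 1" by (simp flip: exp_add)
    then have "even_hermite n t - ?h x = exp (t\<^sup>2 / 2) * (exp (- t\<^sup>2 / 2) * even_hermite n t - hermite_approx \<nu> t)"
      by (simp only: right_diff_distrib mult.assoc[symmetric] mult_1_left t_def)
    also have "\<bar>\<dots>\<bar> \<le> (1 + 3 / 4 * t\<^sup>2) * (59 / 100 * t\<^sup>2 / \<nu>\<^sup>2)"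
      unfolding abs_mult
    proof (intro mult_mono)
      have "exp (t\<^sup>2 / 2) \<le> 1 + t\<^sup>2 / 2 + (t\<^sup>2 / 2)\<^sup>2"
        using t2 by (intro exp_bound) auto
      also have "(t\<^sup>2 / 2)\<^sup>2 \<le> t\<^sup>2 / 4"
        using mult_right_mono[OF t2, of "t\<^sup>2"] by (simp add: power2_eq_square)
      finally show "\<bar>exp (t\<^sup>2 / 2)\<bar> \<le> 1 + 3 / 4 * t\<^sup>2" by simp
      show "\<bar>exp (- t\<^sup>2 / 2) * even_hermite n t - hermite_approx \<nu> t\<bar> \<le> 59 / 100 * t\<^sup>2 / \<nu>\<^sup>2"
        unfolding \<nu>_def by (rule even_hermite_approx[OF assms(1) t])
    qed auto
    also have "\<dots> = 59 / 100 / \<nu>\<^sup>2 * (t ^ (2 * 1) + 3 / 4 * t ^ (2 * 2))"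
    proof -
      have "t ^ (2 * 2) = t\<^sup>2 * t\<^sup>2" by (simp flip: power_add)
      moreover have "(1 + 3 / 4 * y) * (59 / 100 * y / z) = 59 / 100 / z * (y + 3 / 4 * (y * y))" for y z :: real
        by (simp add: algebra_simps add_divide_distrib)
      ultimately show ?thesis by (simp only: mult_1_right)
    qed
    finally show ?thesis by (simp add: t_def)
  qed
  then have "norm (pi / 2 * laguerre_at_1 n - J) \<le> 59 / 100 / \<nu>\<^sup>2 * (pi / 2 * (fact (2 * 1) / (4 ^ 1 * (fact 1)\<^sup>2)) + 3 / 4 * (pi / 2 * (fact (2 * 2) / (4 ^ 2 * (fact 2)\<^sup>2))))"
    using integral_norm_bound_integral[of "\<lambda>x. even_hermite n (sin x) - ?h x" "{0..pi/2}" "\<lambda>x. 59 / 100 / \<nu>\<^sup>2 * (sin x ^ (2 * 1) + 3 / 4 * sin x ^ (2 * 2))"]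
      has_integral_diff[OF has_integral_even_hermite_sin J] bound
    unfolding has_integral_iff by (metis (no_types, lifting))
  also have "\<dots> = pi / 2 * (59 / 100 * (25 / 32) / \<nu>\<^sup>2)"
    by (simp add: fact_numeral field_simps)
  also have "\<dots> \<le> pi / 2 * (47 / 100 / \<nu>\<^sup>2)"
    using \<nu> by (intro mult_left_mono divide_right_mono) auto
  finally have 1: "\<bar>pi / 2 * laguerre_at_1 n - J\<bar> \<le> pi / 2 * (47 / 100 / \<nu>\<^sup>2)" by simp
  define K where "K = cos (\<nu> - pi / 4) - 5 / 24 / \<nu> * sin (\<nu> - pi / 4)"
  define q where "q = sqrt (exp 1 / pi) * sqrt (2 / \<nu>)"
  have amp: "sqrt (exp 1 / 2) * (sqrt pi / sqrt \<nu>) = pi / 2 * q"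
  proof -
    have "sqrt (exp 1 / 2) * (sqrt pi / sqrt \<nu>) = sqrt (exp 1 / 2 * (pi / \<nu>))"
      by (simp only: real_sqrt_mult real_sqrt_divide)
    also have "exp 1 / 2 * (pi / \<nu>) = (pi / 2)\<^sup>2 * (exp 1 / pi * (2 / \<nu>))"
      by (simp add: power2_eq_square)
    also have "sqrt \<dots> = pi / 2 * q"
      by (simp only: q_def real_sqrt_mult real_sqrt_abs) simp
    finally show ?thesis .
  qed
  have 2: "\<bar>J - pi / 2 * (q * K)\<bar> \<le> pi / 2 * (169 / 160 * q / \<nu>\<^sup>2)"
  proof -
    have "sqrt (exp 1 / 2) * (sqrt pi / sqrt \<nu> * K) = pi / 2 * (q * K)"
      using amp by (simp only: mult.assoc[symmetric])
    moreover have "sqrt (exp 1 / 2) * (169 / 160 * (sqrt pi / sqrt \<nu>) / \<nu>\<^sup>2)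
        = 169 / 160 * (sqrt (exp 1 / 2) * (sqrt pi / sqrt \<nu>)) / \<nu>\<^sup>2"
      by simp
    ultimately show ?thesis
      using integral_hermite_approx_asymptotics[OF \<nu> J] unfolding K_def[symmetric] amp by simp
  qed
  have "pi / 2 * \<bar>laguerre_at_1 n - q * K\<bar> = \<bar>pi / 2 * laguerre_at_1 n - pi / 2 * (q * K)\<bar>"
  proof -
    have "\<bar>pi / 2 * x\<bar> = pi / 2 * \<bar>x\<bar>" for x by (simp add: abs_mult)
    from this[of "laguerre_at_1 n - q * K"] show ?thesis by (simp only: right_diff_distrib)
  qed
  also have "\<dots> \<le> pi / 2 * (47 / 100 / \<nu>\<^sup>2) + pi / 2 * (169 / 160 * q / \<nu>\<^sup>2)"
    using 1 2 by linarith
  also have "\<dots> = pi / 2 * ((169 / 160 * q + 47 / 100) / \<nu>\<^sup>2)"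
    by (simp add: algebra_simps add_divide_distrib)
  finally have "\<bar>laguerre_at_1 n - q * K\<bar> \<le> (169 / 160 * q + 47 / 100) / \<nu>\<^sup>2"
    by (rule mult_left_le_imp_le) simp
  then show ?thesis unfolding q_def K_def by (simp only: mult_ac)
qed

theorem theorem2:
  fixes n :: nat
  assumes "n \<ge> 1"
  shows "\<bar>poly (Q n) 1 - (-1) ^ n *
           (sqrt (exp 1 / pi) * (fact n / real n powr (1/4)) * cos (2 * sqrt (real n) - pi / 4)
            - 17 / 48 * sqrt (exp 1 / pi) * (fact n / real n powr (3/4)) * sin (2 * sqrt (real n) - pi / 4))\<bar>
         < 51 / 100 * fact n / real n"
proof -
  define \<nu> where "\<nu> = sqrt (4 * real n + 1)"
  define \<omega> where "\<omega> = 2 * sqrt (real n) - pi / 4"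
  define q where "q = sqrt (exp 1 / pi)"
  define X where "X = sqrt (2 / \<nu>) * (cos (\<nu> - pi / 4) - 5 / 24 / \<nu> * sin (\<nu> - pi / 4))"
  define Y where "Y = cos \<omega> / real n powr (1 / 4) - 17 / 48 * (sin \<omega> / real n powr (3 / 4))"
  have n: "real n > 0" using assms by simp
  have q0: "q \<ge> 0" by (simp add: q_def)
  have q: "q \<le> 931 / 1000"
  proof -
    have "exp 1 \<le> (931 / 1000)\<^sup>2 * pi"
      using e_less_272 pi_approx(1) by (simp add: power2_eq_square)
    then show ?thesis unfolding q_def by (intro real_le_lsqrt) (simp_all add: divide_le_eq)
  qed
  have \<nu>: "\<nu> \<ge> 2236 / 1000" "\<nu>\<^sup>2 \<ge> 4 * real n"
  proof -
    show "\<nu> \<ge> 2236 / 1000"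
      unfolding \<nu>_def using assms by (intro real_le_rsqrt) (simp add: power2_eq_square)
    show "\<nu>\<^sup>2 \<ge> 4 * real n" by (simp add: \<nu>_def)
  qed
  \<comment> \<open>This is where the size of \<open>\<nu>\<close> for \<open>n = 1\<close> matters: \<open>2 / sqrt 5 < 0.946\<^sup>2\<close>.\<close>
  have amp: "sqrt (2 / \<nu>) \<le> 946 / 1000"
    using \<nu> by (intro real_le_lsqrt) (simp_all add: field_simps power2_eq_square)
  have "\<bar>laguerre_at_1 n - q * X\<bar> \<le> (q * (169 / 160 * sqrt (2 / \<nu>)) + 47 / 100) / \<nu>\<^sup>2"
    unfolding q_def X_def \<nu>_def by (rule laguerre_at_1_asymptotics[OF assms])
  also have "\<dots> \<le> (931 / 1000 * (169 / 160 * (946 / 1000)) + 47 / 100) / (4 * real n)"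
    using q q0 amp \<nu> n by (intro frac_le add_mono mult_mono) auto
  also have "\<dots> \<le> 351 / 1000 / real n" using n by (simp add: field_simps)
  finally have 1: "\<bar>laguerre_at_1 n - q * X\<bar> \<le> 351 / 1000 / real n" .
  have "\<bar>X - Y\<bar> \<le> 161 / 1000 / real n"
    unfolding X_def Y_def \<nu>_def \<omega>_def by (rule phase_change[OF assms])
  then have "q * \<bar>X - Y\<bar> \<le> 931 / 1000 * (161 / 1000 / real n)"
    using q q0 by (intro mult_mono) auto
  then have 2: "\<bar>q * X - q * Y\<bar> \<le> 931 / 1000 * (161 / 1000 / real n)"
    using q0 by (simp add: abs_mult flip: right_diff_distrib)
  have "\<bar>laguerre_at_1 n - q * Y\<bar> \<le> 351 / 1000 / real n + 931 / 1000 * (161 / 1000 / real n)"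
    using 1 2 by linarith
  also have "\<dots> < 51 / 100 / real n" using n by (simp add: field_simps)
  finally have main: "\<bar>laguerre_at_1 n - q * Y\<bar> < 51 / 100 / real n" .
  have "poly (Q n) 1 - (-1) ^ n * (q * (fact n / real n powr (1/4)) * cos \<omega>
            - 17 / 48 * q * (fact n / real n powr (3/4)) * sin \<omega>)
      = (-1) ^ n * (fact n * (laguerre_at_1 n - q * Y))"
    unfolding poly_Q_1 Y_def by (simp add: algebra_simps)
  then have "\<bar>poly (Q n) 1 - (-1) ^ n * (q * (fact n / real n powr (1/4)) * cos \<omega>
            - 17 / 48 * q * (fact n / real n powr (3/4)) * sin \<omega>)\<bar> = fact n * \<bar>laguerre_at_1 n - q * Y\<bar>"
    by (simp add: abs_mult power_abs)
  also have "\<dots> < fact n * (51 / 100 / real n)"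
    using main by (intro mult_strict_left_mono) auto
  also have "\<dots> = 51 / 100 * fact n / real n" by simp
  finally show ?thesis by (simp only: q_def \<omega>_def)
qed

end
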